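(* The collection $\{V_j: j\in\mathbb{Z}\}$, where $V_j=\overline{\mathrm{span}\{\phi(2^{-j}\cdot-a):a\in I_2\}}$ and $\phi$ is the characteristic function of $\mathbb{Z}_2$, is a multiresolution analysis in $\mathcal{L}^2(\mathbb{Q}_2)$, and the function $\psi^{(0)}(x)=\phi\big(\frac{x}{2}\big)-\phi\big(\frac{x}{2}-\frac12\big)$ is a wavelet function for it.
   Context: $\mathbb{Q}_p$ is the field of $p$-adic numbers with Haar measure normalized so that $\mathbb{Z}_p$ has measure $1$; $\mathcal{L}^2(\mathbb{Q}_p)$ is the space of complex-valued square-integrable functions. $I_p=\{p^{-\gamma}(a_0+a_1p+\cdots+a_{\gamma-1}p^{\gamma-1}):\gamma\in\mathbb{N},\ a_j\in\{0,1,\dots,p-1\}\}\subset\mathbb{Q}_p$ (a set of representatives of $\mathbb{Q}_p/\mathbb{Z}_p$, containing $0$). A collection of closed subspaces $V_j\subset\mathcal{L}^2(\mathbb{Q}_p)$, $j\in\mathbb{Z}$, is a multiresolution analysis (MRA) in $\mathcal{L}^2(\mathbb{Q}_p)$ if: (a) $V_j\subset V_{j+1}$ for all $j$; (b) $\bigcup_j V_j$ is dense in $\mathcal{L}^2(\mathbb{Q}_p)$; (c) $\bigcap_j V_j=\{0\}$; (d) $f(\cdot)\in V_j\Leftrightarrow f(p^{-1}\cdot)\in V_{j+1}$ for all $j$; (e) there is a function $\phi\in V_0$ (called refinable) such that $\{\phi(\cdot-a):a\in I_p\}$ is an orthonormal basis of $V_0$. Let $W_0$ be the orthogonal complement of $V_0$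 in $V_1$. A wavelet function is a function $\psi\in W_0$ such that $\{\psi(\cdot-a):a\in I_p\}$ is an orthonormal basis of $W_0$. Here $p=2$. *)

theory Defs
  imports
    "HOL-Analysis.Analysis"
    "HOL-Computational_Algebra.Primes"
    "HOL-Library.Function_Algebras"
begin

section \<open>The \<open>p\<close>-adic absolute value on the rationals\<close>

definition padic_abs :: "nat \<Rightarrow> rat \<Rightarrow> real" where
  "padic_abs p q = (if q = 0 then 0 else
     (case quotient_of q of (a, b) \<Rightarrow>
       real p powi (int (multiplicity (int p) b) - int (multiplicity (int p) a))))"

lemma padic_abs_0 [simp]: "padic_abs p 0 = 0"
  by (simp add: padic_abs_def)

lemma padic_abs_fraction:
  assumes p: "prime p" and a: "a \<noteq> 0" and b: "b \<noteq> 0"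
  shows "padic_abs p (of_int a / of_int b) =
    real p powi (int (multiplicity (int p) b) - int (multiplicity (int p) a))"
proof -
  define q :: rat where "q = of_int a / of_int b"
  obtain n d where nd: "quotient_of q = (n, d)"
    by (cases "quotient_of q")
  have q0: "q \<noteq> 0" using a b by (simp add: q_def)
  have d: "d > 0" using nd by (rule quotient_of_denom_pos)
  have qnd: "q = of_int n / of_int d" using nd by (rule quotient_of_div)
  have n: "n \<noteq> 0" using qnd q0 by auto
  have "(of_int (n * b) :: rat) = of_int (a * d)"
    using qnd q_def b d by (simp add: field_simps)
  then have eq: "n * b = a * d" by (simp only: of_int_eq_iff)
  have pe: "prime_elem (int p)" using p by simp
  have "multiplicity (int p) n + multiplicity (int p) b = multiplicity (int p) (n * b)"
    using prime_elem_multiplicity_mult_distrib[OF pe n b] by simp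
  also have "\<dots> = multiplicity (int p) a + multiplicity (int p) d"
    using prime_elem_multiplicity_mult_distrib[OF pe a, of d] d eq by simp
  finally have "int (multiplicity (int p) d) - int (multiplicity (int p) n) =
      int (multiplicity (int p) b) - int (multiplicity (int p) a)"
    by linarith
  then show ?thesis
    using q0 nd by (simp add: padic_abs_def q_def[symmetric])
qed

lemma rat_common_fraction:
  fixes x y :: rat
  obtains a b c where "x = of_int a / of_int c" "y = of_int b / of_int c" "c \<noteq> 0"
proof -
  obtain n d m e where *: "quotient_of x = (n, d)" "quotient_of y = (m, e)"
    by (metis surj_pair)
  have "d > 0" "e > 0" using * by (auto dest: quotient_of_denom_pos)
  moreover have "x = of_int n / of_int d" "y = of_int m / of_int e"
    using * by (auto dest: quotient_of_div)
  ultimately show ?thesis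
    by (intro that[of "n * e" "d * e" "m * d"]) auto
qed

lemma padic_abs_nonneg [simp]: "padic_abs p x \<ge> 0"
  by (auto simp: padic_abs_def split: prod.split)

lemma padic_abs_eq_0_iff [simp]: "prime p \<Longrightarrow> padic_abs p x = 0 \<longleftrightarrow> x = 0"
  by (auto simp: padic_abs_def power_int_eq_0_iff split: prod.splits)

lemma padic_abs_1 [simp]: "padic_abs p 1 = 1"
  by (simp add: padic_abs_def)

lemma padic_abs_mult:
  assumes p: "prime p"
  shows "padic_abs p (x * y) = padic_abs p x * padic_abs p y"
proof (cases "x = 0 \<or> y = 0")
  case True then show ?thesis by auto
next
  case False
  obtain a b c where abc: "x = of_int a / of_int c" "y = of_int b / of_int c" "c \<noteq> 0"
    by (rule rat_common_fraction)
  have ab: "a \<noteq> 0" "b \<noteq> 0" using False abc by auto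
  have pe: "prime_elem (int p)" using p by simp
  have xy: "x * y = of_int (a * b) / of_int (c * c)" using abc by simp
  have p0: "real p \<noteq> 0" using p by auto
  show ?thesis
    unfolding xy using abc ab p
    by (simp add: padic_abs_fraction prime_elem_multiplicity_mult_distrib[OF pe]
        power_int_add[symmetric] p0 diff_diff_eq2 algebra_simps del: of_int_mult)
qed

lemma padic_abs_minus [simp]:
  assumes p: "prime p"
  shows "padic_abs p (- x) = padic_abs p x"
proof -
  have "padic_abs p (- 1) * padic_abs p (- 1) = 1"
    using padic_abs_mult[OF p, of "- 1" "- 1"] by simp
  then have "padic_abs p (- 1) = 1"
    using padic_abs_nonneg[of p "- 1"]
    by (simp add: power2_eq_square[symmetric] power2_eq_1_iff)
  then show ?thesis
    using padic_abs_mult[OF p, of "- 1" x] by simp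
qed

lemma padic_abs_add_le_max:
  assumes p: "prime p"
  shows "padic_abs p (x + y) \<le> max (padic_abs p x) (padic_abs p y)"
proof (cases "x = 0 \<or> y = 0 \<or> x + y = 0")
  case True then show ?thesis by (auto simp: le_max_iff_disj)
next
  case False
  obtain a b c where abc: "x = of_int a / of_int c" "y = of_int b / of_int c" "c \<noteq> 0"
    by (rule rat_common_fraction)
  have xy: "x + y = of_int (a + b) / of_int c"
    using abc by (simp add: add_divide_distrib)
  have ab: "a \<noteq> 0" "b \<noteq> 0" "a + b \<noteq> 0" using False abc xy by auto
  let ?m = "multiplicity (int p)"
  have np: "\<not> is_unit (int p)" using p by auto
  have "int p ^ min (?m a) (?m b) dvd a + b"
    by (intro dvd_add multiplicity_dvd') auto
  then have min: "min (?m a) (?m b) \<le> ?m (a + b)"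
    using ab np by (intro multiplicity_geI) auto
  have p1: "real p \<ge> 1" using p prime_ge_1_nat[of p] by simp
  have "real p powi (int (?m c) - int (?m (a + b))) \<le> real p powi (int (?m c) - int (?m a)) \<or>
      real p powi (int (?m c) - int (?m (a + b))) \<le> real p powi (int (?m c) - int (?m b))"
    using min p1 by (cases "?m a \<le> ?m b") (auto intro!: power_int_increasing)
  then show ?thesis
    unfolding xy using abc ab p
    by (simp add: padic_abs_fraction le_max_iff_disj del: of_int_add)
qed

lemma padic_abs_add_le:
  "prime p \<Longrightarrow> padic_abs p (x + y) \<le> padic_abs p x + padic_abs p y"
  using padic_abs_add_le_max[of p x y] padic_abs_nonneg[of p x] padic_abs_nonneg[of p y]
  by linarith

lemma padic_abs_diff_le:
  "prime p \<Longrightarrow> padic_abs p (x - y) \<le> padic_abs p x + padic_abs p y"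
  using padic_abs_add_le[of p x "- y"] by simp

lemma padic_abs_triangle3:
  "prime p \<Longrightarrow> \<bar>padic_abs p x - padic_abs p y\<bar> \<le> padic_abs p (x - y)"
  using padic_abs_add_le[of p "x - y" y] padic_abs_add_le[of p "y - x" x]
    padic_abs_minus[of p "x - y"] by simp

lemma padic_abs_inverse:
  "prime p \<Longrightarrow> padic_abs p (inverse x) = inverse (padic_abs p x)"
  using padic_abs_mult[of p x "inverse x"]
  by (cases "x = 0") (auto simp: field_simps)


section \<open>Cauchy sequences and null sequences\<close>

definition padic_null :: "nat \<Rightarrow> (nat \<Rightarrow> rat) \<Rightarrow> bool" where
  "padic_null p X \<longleftrightarrow> (\<lambda>n. padic_abs p (X n)) \<longlonglongrightarrow> 0"

definition padic_cauchy :: "nat \<Rightarrow> (nat \<Rightarrow> rat) \<Rightarrow> bool" where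
  "padic_cauchy p X \<longleftrightarrow> (\<forall>e>0. \<exists>k. \<forall>m\<ge>k. \<forall>n\<ge>k. padic_abs p (X m - X n) < e)"

lemma padic_null_le:
  assumes "padic_null p X" "\<forall>\<^sub>F n in sequentially. padic_abs p (Y n) \<le> c * padic_abs p (X n)"
  shows "padic_null p Y"
  unfolding padic_null_def
proof (rule tendsto_sandwich[OF _ assms(2)])
  show "\<forall>\<^sub>F n in sequentially. 0 \<le> padic_abs p (Y n)" by simp
  show "(\<lambda>n. c * padic_abs p (X n)) \<longlonglongrightarrow> 0"
    using tendsto_mult_left[of "\<lambda>n. padic_abs p (X n)" 0 _ c] assms(1)
    by (simp add: padic_null_def)
qed simp

lemma padic_null_minus: "prime p \<Longrightarrow> padic_null p X \<Longrightarrow> padic_null p (\<lambda>n. - X n)"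
  by (simp add: padic_null_def)

lemma padic_null_add:
  assumes p: "prime p" and X: "padic_null p X" and Y: "padic_null p Y"
  shows "padic_null p (\<lambda>n. X n + Y n)"
proof -
  have "(\<lambda>n. padic_abs p (X n) + padic_abs p (Y n)) \<longlonglongrightarrow> 0"
    using tendsto_add[of "\<lambda>n. padic_abs p (X n)" 0 _ "\<lambda>n. padic_abs p (Y n)" 0] X Y
    by (simp add: padic_null_def)
  then show ?thesis
    unfolding padic_null_def
    by (rule Lim_null_comparison[rotated]) (simp add: padic_abs_add_le p)
qed

lemma padic_cauchy_const: "padic_cauchy p (\<lambda>n. c)"
  by (simp add: padic_cauchy_def)

lemma padic_cauchy_add:
  assumes p: "prime p" and X: "padic_cauchy p X" and Y: "padic_cauchy p Y"
  shows "padic_cauchy p (\<lambda>n. X n + Y n)"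
  unfolding padic_cauchy_def
proof safe
  fix e :: real assume e: "e > 0"
  obtain k where k: "\<forall>m\<ge>k. \<forall>n\<ge>k. padic_abs p (X m - X n) < e / 2"
    using X e unfolding padic_cauchy_def by (meson half_gt_zero)
  obtain l where l: "\<forall>m\<ge>l. \<forall>n\<ge>l. padic_abs p (Y m - Y n) < e / 2"
    using Y e unfolding padic_cauchy_def by (meson half_gt_zero)
  have "padic_abs p (X m + Y m - (X n + Y n)) < e" if "m \<ge> max k l" "n \<ge> max k l" for m n
  proof -
    have "padic_abs p (X m + Y m - (X n + Y n)) \<le> padic_abs p (X m - X n) + padic_abs p (Y m - Y n)"
      using padic_abs_add_le[OF p, of "X m - X n" "Y m - Y n"] by (simp add: algebra_simps)
    moreover have "padic_abs p (X m - X n) < e / 2" "padic_abs p (Y m - Y n) < e / 2"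
      using k l that by auto
    ultimately show ?thesis by linarith
  qed
  then show "\<exists>k. \<forall>m\<ge>k. \<forall>n\<ge>k. padic_abs p (X m + Y m - (X n + Y n)) < e" by blast
qed

lemma padic_cauchy_minus:
  assumes p: "prime p" and X: "padic_cauchy p X"
  shows "padic_cauchy p (\<lambda>n. - X n)"
proof -
  have "padic_abs p (- X m - - X n) = padic_abs p (X m - X n)" for m n
    using padic_abs_minus[OF p, of "X m - X n"] by (simp add: algebra_simps)
  then show ?thesis using X by (simp add: padic_cauchy_def)
qed

lemma padic_cauchy_abs_convergent:
  assumes p: "prime p" and X: "padic_cauchy p X"
  shows "convergent (\<lambda>n. padic_abs p (X n))"
  unfolding Cauchy_convergent_iff[symmetric]
proof (rule metric_CauchyI)
  fix e :: real assume "e > 0"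
  then obtain k where "\<forall>m\<ge>k. \<forall>n\<ge>k. padic_abs p (X m - X n) < e"
    using X by (auto simp: padic_cauchy_def)
  then show "\<exists>M. \<forall>m\<ge>M. \<forall>n\<ge>M. dist (padic_abs p (X m)) (padic_abs p (X n)) < e"
    using padic_abs_triangle3[OF p] unfolding dist_real_def by (meson le_less_trans)
qed

lemma padic_cauchy_bounded:
  assumes p: "prime p" and X: "padic_cauchy p X"
  obtains B where "B > 0" "\<And>n. padic_abs p (X n) \<le> B"
proof -
  have "Bseq (\<lambda>n. padic_abs p (X n))"
    using padic_cauchy_abs_convergent[OF p X] by (rule convergent_imp_Bseq)
  then show ?thesis using that unfolding Bseq_def by auto
qed

lemma padic_cauchy_mult:
  assumes p: "prime p" and X: "padic_cauchy p X" and Y: "padic_cauchy p Y"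
  shows "padic_cauchy p (\<lambda>n. X n * Y n)"
  unfolding padic_cauchy_def
proof safe
  fix e :: real assume e: "e > 0"
  obtain A where A: "A > 0" "\<And>n. padic_abs p (X n) \<le> A" using padic_cauchy_bounded[OF p X] by blast
  obtain B where B: "B > 0" "\<And>n. padic_abs p (Y n) \<le> B" using padic_cauchy_bounded[OF p Y] by blast
  have "e / (2 * B) > 0" "e / (2 * A) > 0" using e A B by auto
  then obtain k l where k: "\<forall>m\<ge>k. \<forall>n\<ge>k. padic_abs p (X m - X n) < e / (2 * B)"
    and l: "\<forall>m\<ge>l. \<forall>n\<ge>l. padic_abs p (Y m - Y n) < e / (2 * A)"
    using X Y unfolding padic_cauchy_def by meson
  have "padic_abs p (X m * Y m - X n * Y n) < e" if "m \<ge> max k l" "n \<ge> max k l" for m n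
  proof -
    have "X m * Y m - X n * Y n = (X m - X n) * Y m + X n * (Y m - Y n)"
      by (simp add: algebra_simps)
    then have "padic_abs p (X m * Y m - X n * Y n) \<le>
        padic_abs p (X m - X n) * padic_abs p (Y m) + padic_abs p (X n) * padic_abs p (Y m - Y n)"
      using padic_abs_add_le[OF p, of "(X m - X n) * Y m" "X n * (Y m - Y n)"]
      by (simp add: padic_abs_mult[OF p])
    also have "\<dots> \<le> padic_abs p (X m - X n) * B + A * padic_abs p (Y m - Y n)"
      using A B by (intro add_mono mult_mono) auto
    also have "\<dots> < e / (2 * B) * B + A * (e / (2 * A))"
      using k l that A B by (intro add_strict_mono mult_strict_left_mono mult_strict_right_mono) auto
    also have "\<dots> = e" using A B by simp
    finally show ?thesis .
  qed
  then show "\<exists>k. \<forall>m\<ge>k. \<forall>n\<ge>k. padic_abs p (X m * Y m - X n * Y n) < e" by blast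
qed

lemma padic_null_mult_cauchy:
  assumes p: "prime p" and X: "padic_cauchy p X" and Y: "padic_null p Y"
  shows "padic_null p (\<lambda>n. X n * Y n)"
proof -
  obtain A where "A > 0" "\<And>n. padic_abs p (X n) \<le> A" using padic_cauchy_bounded[OF p X] by blast
  then show ?thesis
    using Y by (intro padic_null_le[OF Y, of _ A] always_eventually)
      (auto simp: padic_abs_mult[OF p] intro: mult_right_mono)
qed

lemma padic_cauchy_away:
  assumes p: "prime p" and X: "padic_cauchy p X" and nn: "\<not> padic_null p X"
  obtains c k where "c > 0" "\<And>n. n \<ge> k \<Longrightarrow> padic_abs p (X n) > c"
proof -
  obtain l where l: "(\<lambda>n. padic_abs p (X n)) \<longlonglongrightarrow> l"
    using padic_cauchy_abs_convergent[OF p X] by (auto simp: convergent_def)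
  have "l \<ge> 0" using LIMSEQ_le_const[OF l, of 0] by auto
  moreover have "l \<noteq> 0" using nn l by (auto simp: padic_null_def)
  ultimately have l0: "l > 0" by simp
  have "\<forall>\<^sub>F n in sequentially. padic_abs p (X n) > l / 2"
    using order_tendstoD(1)[OF l, of "l / 2"] l0 by simp
  then show ?thesis using that[of "l / 2"] l0 by (auto simp: eventually_sequentially)
qed

lemma padic_cauchy_inverse:
  assumes p: "prime p" and X: "padic_cauchy p X" and nn: "\<not> padic_null p X"
  shows "padic_cauchy p (\<lambda>n. inverse (X n))"
  unfolding padic_cauchy_def
proof safe
  fix e :: real assume e: "e > 0"
  obtain c k where c: "c > 0" "\<And>n. n \<ge> k \<Longrightarrow> padic_abs p (X n) > c"
    using padic_cauchy_away[OF p X nn] by blast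
  have "e * (c * c) > 0" using e c by simp
  then obtain l where l: "\<forall>m\<ge>l. \<forall>n\<ge>l. padic_abs p (X m - X n) < e * (c * c)"
    using X unfolding padic_cauchy_def by meson
  have "padic_abs p (inverse (X m) - inverse (X n)) < e" if "m \<ge> max k l" "n \<ge> max k l" for m n
  proof -
    have cm: "padic_abs p (X m) > c" "padic_abs p (X n) > c" using c that by auto
    then have nz: "X m \<noteq> 0" "X n \<noteq> 0" using c by auto
    have "inverse (X m) - inverse (X n) = (X n - X m) * inverse (X m * X n)"
      using nz by (simp add: field_simps)
    then have "padic_abs p (inverse (X m) - inverse (X n)) =
        padic_abs p (X n - X m) / (padic_abs p (X m) * padic_abs p (X n))"
      by (simp add: padic_abs_mult[OF p] padic_abs_inverse[OF p] divide_inverse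
          del: inverse_mult_distrib)
    also have "\<dots> \<le> padic_abs p (X n - X m) / (c * c)"
      using cm c by (intro divide_left_mono mult_mono mult_pos_pos) auto
    also have "\<dots> < e" using l that c by (simp add: pos_divide_less_eq)
    finally show ?thesis .
  qed
  then show "\<exists>k. \<forall>m\<ge>k. \<forall>n\<ge>k. padic_abs p (inverse (X m) - inverse (X n)) < e" by blast
qed

definition padic_rel :: "nat \<Rightarrow> (nat \<Rightarrow> rat) \<Rightarrow> (nat \<Rightarrow> rat) \<Rightarrow> bool" where
  "padic_rel p X Y \<longleftrightarrow> padic_cauchy p X \<and> padic_cauchy p Y \<and> padic_null p (\<lambda>n. X n - Y n)"

lemma padic_rel_refl: "padic_cauchy p X \<Longrightarrow> padic_rel p X X"
  by (simp add: padic_rel_def padic_null_def)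

lemma padic_relD: "padic_rel p X Y \<Longrightarrow> padic_cauchy p X"
  by (simp add: padic_rel_def)

lemma padic_rel_eqI: "padic_cauchy p X \<Longrightarrow> (\<And>n. X n = Y n) \<Longrightarrow> padic_rel p X Y"
  by (metis ext padic_rel_refl)

lemma part_equivp_padic_rel: "prime p \<Longrightarrow> part_equivp (padic_rel p)"
proof (rule part_equivpI)
  assume p: "prime p"
  show "\<exists>X. padic_rel p X X" using padic_rel_refl padic_cauchy_const by blast
  show "symp (padic_rel p)"
    using padic_null_minus[OF p] by (fastforce intro!: sympI simp: padic_rel_def)
  show "transp (padic_rel p)"
  proof (rule transpI)
    fix X Y Z assume "padic_rel p X Y" "padic_rel p Y Z"
    then show "padic_rel p X Z"
      using padic_null_add[OF p, of "\<lambda>n. X n - Y n" "\<lambda>n. Y n - Z n"]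
      by (simp add: padic_rel_def)
  qed
qed

lemma padic_rel_abs_lim:
  assumes p: "prime p" and XY: "padic_rel p X Y"
  shows "lim (\<lambda>n. padic_abs p (X n)) = lim (\<lambda>n. padic_abs p (Y n))"
proof -
  have "convergent (\<lambda>n. padic_abs p (Y n))"
    using XY padic_cauchy_abs_convergent[OF p] by (simp add: padic_rel_def)
  then obtain l where l: "(\<lambda>n. padic_abs p (Y n)) \<longlonglongrightarrow> l" by (auto simp: convergent_def)
  have "(\<lambda>n. padic_abs p (X n) - padic_abs p (Y n)) \<longlonglongrightarrow> 0"
    by (rule Lim_null_comparison[of _ "\<lambda>n. padic_abs p (X n - Y n)"])
      (use XY padic_abs_triangle3[OF p] in \<open>auto simp: padic_rel_def padic_null_def\<close>)
  from tendsto_add[OF this l] have "(\<lambda>n. padic_abs p (X n)) \<longlonglongrightarrow> l" by simp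
  with l show ?thesis by (simp add: limI)
qed


section \<open>The field of 2-adic numbers\<close>

lemma two_prime_nat: "prime (2 :: nat)"
  by simp

quotient_type Q2 = "nat \<Rightarrow> rat" / partial: "padic_rel 2"
  by (rule part_equivp_padic_rel[OF two_prime_nat])

instantiation Q2 :: field
begin

lift_definition zero_Q2 :: Q2 is "\<lambda>n. 0"
  by (rule padic_rel_refl[OF padic_cauchy_const])

lift_definition one_Q2 :: Q2 is "\<lambda>n. 1"
  by (rule padic_rel_refl[OF padic_cauchy_const])

lift_definition plus_Q2 :: "Q2 \<Rightarrow> Q2 \<Rightarrow> Q2" is "\<lambda>X Y n. X n + Y n"
  unfolding padic_rel_def add_diff_add
  by (simp add: padic_cauchy_add padic_null_add)

lift_definition uminus_Q2 :: "Q2 \<Rightarrow> Q2" is "\<lambda>X n. - X n"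
  unfolding padic_rel_def minus_diff_minus
  by (simp add: padic_cauchy_minus padic_null_minus del: minus_diff_eq)

lift_definition times_Q2 :: "Q2 \<Rightarrow> Q2 \<Rightarrow> Q2" is "\<lambda>X Y n. X n * Y n"
proof -
  fix X X' Y Y' assume *: "padic_rel 2 X X'" "padic_rel 2 Y Y'"
  then have "padic_null 2 (\<lambda>n. X n * (Y n - Y' n) + Y' n * (X n - X' n))"
    by (intro padic_null_add padic_null_mult_cauchy) (auto simp: padic_rel_def)
  moreover have "(\<lambda>n. X n * (Y n - Y' n) + Y' n * (X n - X' n)) = (\<lambda>n. X n * Y n - X' n * Y' n)"
    by (simp add: algebra_simps)
  ultimately show "padic_rel 2 (\<lambda>n. X n * Y n) (\<lambda>n. X' n * Y' n)"
    using * by (simp add: padic_rel_def padic_cauchy_mult)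
qed

lift_definition inverse_Q2 :: "Q2 \<Rightarrow> Q2"
  is "\<lambda>X. if padic_null 2 X then (\<lambda>n. 0) else (\<lambda>n. inverse (X n))"
proof -
  fix X Y assume "padic_rel 2 X Y"
  then have X: "padic_cauchy 2 X" and Y: "padic_cauchy 2 Y" and XY: "padic_null 2 (\<lambda>n. X n - Y n)"
    by (simp_all add: padic_rel_def)
  have iff: "padic_null 2 X \<longleftrightarrow> padic_null 2 Y"
    using padic_null_add[OF two_prime_nat XY, of Y]
      padic_null_add[OF two_prime_nat padic_null_minus[OF two_prime_nat XY], of X]
    by auto
  show "padic_rel 2 (if padic_null 2 X then (\<lambda>n. 0) else (\<lambda>n. inverse (X n)))
          (if padic_null 2 Y then (\<lambda>n. 0) else (\<lambda>n. inverse (Y n)))"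
  proof (cases "padic_null 2 X")
    case True
    then show ?thesis using iff by (simp add: padic_rel_refl padic_cauchy_const)
  next
    case False
    then have nY: "\<not> padic_null 2 Y" using iff by simp
    have iX: "padic_cauchy 2 (\<lambda>n. inverse (X n))" and iY: "padic_cauchy 2 (\<lambda>n. inverse (Y n))"
      using X Y False nY by (auto intro: padic_cauchy_inverse)
    obtain c k where c: "c > 0" "\<And>n. n \<ge> k \<Longrightarrow> padic_abs 2 (X n) > c"
      using padic_cauchy_away[OF two_prime_nat X False] by blast
    obtain d l where d: "d > 0" "\<And>n. n \<ge> l \<Longrightarrow> padic_abs 2 (Y n) > d"
      using padic_cauchy_away[OF two_prime_nat Y nY] by blast
    have Z: "padic_null 2 (\<lambda>n. (inverse (X n) * inverse (Y n)) * (X n - Y n))"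
      by (intro padic_null_mult_cauchy padic_cauchy_mult iX iY XY two_prime_nat)
    have "padic_null 2 (\<lambda>n. inverse (X n) - inverse (Y n))"
    proof (rule padic_null_le[OF Z, of _ 1])
      have "padic_abs 2 (inverse (X n) - inverse (Y n)) \<le>
          1 * padic_abs 2 ((inverse (X n) * inverse (Y n)) * (X n - Y n))" if "n \<ge> max k l" for n
      proof -
        have "X n \<noteq> 0" "Y n \<noteq> 0" using c(1) c(2)[of n] d(1) d(2)[of n] that by auto
        then have "inverse (X n) - inverse (Y n) = - ((inverse (X n) * inverse (Y n)) * (X n - Y n))"
          by (simp add: field_simps)
        then show ?thesis by (simp only: padic_abs_minus[OF two_prime_nat] mult_1)
      qed
      then show "\<forall>\<^sub>F n in sequentially. padic_abs 2 (inverse (X n) - inverse (Y n)) \<le>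
          1 * padic_abs 2 ((inverse (X n) * inverse (Y n)) * (X n - Y n))"
        unfolding eventually_sequentially by blast
    qed
    then show ?thesis using iX iY False nY by (simp add: padic_rel_def)
  qed
qed

definition "x - y = x + - y" for x y :: Q2

definition "x div y = x * inverse y" for x y :: Q2

instance
proof
  fix a b c :: Q2
  show "a + b + c = a + (b + c)"
    by transfer (rule padic_rel_eqI; auto intro!: padic_cauchy_add padic_cauchy_mult
        padic_cauchy_minus padic_cauchy_const dest: padic_relD simp: algebra_simps)
  show "a + b = b + a"
    by transfer (rule padic_rel_eqI; auto intro!: padic_cauchy_add padic_cauchy_mult
        padic_cauchy_minus padic_cauchy_const dest: padic_relD simp: algebra_simps)
  show "0 + a = a"
    by transfer (rule padic_rel_eqI; auto intro!: padic_cauchy_add padic_cauchy_mult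
        padic_cauchy_minus padic_cauchy_const dest: padic_relD simp: algebra_simps)
  show "- a + a = 0"
    by transfer (rule padic_rel_eqI; auto intro!: padic_cauchy_add padic_cauchy_mult
        padic_cauchy_minus padic_cauchy_const dest: padic_relD simp: algebra_simps)
  show "a - b = a + - b" by (simp add: minus_Q2_def)
  show "a * b * c = a * (b * c)"
    by transfer (rule padic_rel_eqI; auto intro!: padic_cauchy_add padic_cauchy_mult
        padic_cauchy_minus padic_cauchy_const dest: padic_relD simp: algebra_simps)
  show "a * b = b * a"
    by transfer (rule padic_rel_eqI; auto intro!: padic_cauchy_add padic_cauchy_mult
        padic_cauchy_minus padic_cauchy_const dest: padic_relD simp: algebra_simps)
  show "1 * a = a"
    by transfer (rule padic_rel_eqI; auto intro!: padic_cauchy_add padic_cauchy_mult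
        padic_cauchy_minus padic_cauchy_const dest: padic_relD simp: algebra_simps)
  show "(a + b) * c = a * c + b * c"
    by transfer (rule padic_rel_eqI; auto intro!: padic_cauchy_add padic_cauchy_mult
        padic_cauchy_minus padic_cauchy_const dest: padic_relD simp: algebra_simps)
  show "(0 :: Q2) \<noteq> 1"
    by transfer (simp add: padic_rel_def padic_null_def padic_cauchy_const LIMSEQ_const_iff)
  show "inverse (0 :: Q2) = 0"
    by transfer (simp add: padic_rel_refl padic_cauchy_const padic_null_def)
  show "a div b = a * inverse b" by (simp add: divide_Q2_def)
  show "inverse a * a = 1" if "a \<noteq> 0"
    using that
  proof transfer
    fix X assume "padic_rel 2 X X" and n0: "\<not> padic_rel 2 X (\<lambda>n. 0)"
    then have X: "padic_cauchy 2 X" by (simp add: padic_rel_def)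
    then have nX: "\<not> padic_null 2 X" using n0 by (simp add: padic_rel_def padic_cauchy_const)
    obtain c k where c: "c > 0" "\<And>n. n \<ge> k \<Longrightarrow> padic_abs 2 (X n) > c"
      using padic_cauchy_away[OF two_prime_nat X nX] by blast
    have "\<forall>\<^sub>F n in sequentially. padic_abs 2 (inverse (X n) * X n - 1) = 0"
      unfolding eventually_sequentially using c
      by (metis add.inverse_inverse diff_self left_inverse less_le_not_le order.strict_trans
          padic_abs_0)
    then have "padic_null 2 (\<lambda>n. inverse (X n) * X n - 1)"
      unfolding padic_null_def by (rule tendsto_eventually)
    then show "padic_rel 2 (\<lambda>n. (if padic_null 2 X then \<lambda>n. 0 else (\<lambda>n. inverse (X n))) n * X n) (\<lambda>n. 1)"
      using nX X
      by (simp add: padic_rel_def padic_cauchy_const padic_cauchy_mult padic_cauchy_inverse)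
  qed
qed

end

lift_definition Q2_abs :: "Q2 \<Rightarrow> real" is "\<lambda>X. lim (\<lambda>n. padic_abs 2 (X n))"
  by (rule padic_rel_abs_lim[OF two_prime_nat])

lemma Q2_abs_eq_0_iff: "Q2_abs x = 0 \<longleftrightarrow> x = 0"
proof transfer
  fix X assume "padic_rel 2 X X"
  then have X: "padic_cauchy 2 X" by (simp add: padic_rel_def)
  have "(\<lambda>n. padic_abs 2 (X n)) \<longlonglongrightarrow> lim (\<lambda>n. padic_abs 2 (X n))"
    using padic_cauchy_abs_convergent[OF two_prime_nat X] by (simp only: convergent_LIMSEQ_iff)
  then have "lim (\<lambda>n. padic_abs 2 (X n)) = 0 \<longleftrightarrow> padic_null 2 X"
    unfolding padic_null_def by (metis limI)
  then show "lim (\<lambda>n. padic_abs 2 (X n)) = 0 \<longleftrightarrow> padic_rel 2 X (\<lambda>n. 0)"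
    using X by (simp add: padic_rel_def padic_cauchy_const)
qed

lemma Q2_abs_triangle: "Q2_abs (x + y) \<le> Q2_abs x + Q2_abs y"
proof transfer
  fix X Y assume "padic_rel 2 X X" "padic_rel 2 Y Y"
  then have X: "padic_cauchy 2 X" and Y: "padic_cauchy 2 Y" by (simp_all add: padic_rel_def)
  have lim: "(\<lambda>n. padic_abs 2 (Z n)) \<longlonglongrightarrow> lim (\<lambda>n. padic_abs 2 (Z n))" if "padic_cauchy 2 Z" for Z
    using padic_cauchy_abs_convergent[OF two_prime_nat that] by (simp only: convergent_LIMSEQ_iff)
  show "lim (\<lambda>n. padic_abs 2 (X n + Y n)) \<le>
      lim (\<lambda>n. padic_abs 2 (X n)) + lim (\<lambda>n. padic_abs 2 (Y n))"
    by (rule LIMSEQ_le[OF lim[OF padic_cauchy_add[OF two_prime_nat X Y]]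
          tendsto_add[OF lim[OF X] lim[OF Y]]]) (simp add: padic_abs_add_le)
qed

lemma Q2_abs_minus: "Q2_abs (- x) = Q2_abs x"
  by transfer simp

instantiation Q2 :: metric_space
begin

definition dist_Q2 :: "Q2 \<Rightarrow> Q2 \<Rightarrow> real" where
  "dist_Q2 x y = Q2_abs (x - y)"

definition uniformity_Q2 :: "(Q2 \<times> Q2) filter" where
  "uniformity_Q2 = (INF e\<in>{0 <..}. principal {(x, y). dist x y < e})"

definition open_Q2 :: "Q2 set \<Rightarrow> bool" where
  "open_Q2 U \<longleftrightarrow> (\<forall>x\<in>U. \<forall>\<^sub>F (x', y) in uniformity. x' = x \<longrightarrow> y \<in> U)"

instance
proof
  fix x y z :: Q2
  show "dist x y = 0 \<longleftrightarrow> x = y"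
    by (simp add: dist_Q2_def Q2_abs_eq_0_iff)
  show "dist x y \<le> dist x z + dist y z"
    using Q2_abs_triangle[of "x - z" "z - y"] Q2_abs_minus[of "y - z"]
    by (simp add: dist_Q2_def)
qed (simp_all add: uniformity_Q2_def open_Q2_def)

end

text \<open>The ring of 2-adic integers and the standard representatives of \<open>\<rat>\<^sub>2 / \<int>\<^sub>2\<close>.\<close>

definition Z2 :: "Q2 set" where
  "Z2 = {x. Q2_abs x \<le> 1}"

definition I2 :: "Q2 set" where
  "I2 = {2 powi (- int \<gamma>) * (\<Sum>j<\<gamma>. of_nat (a j) * 2 ^ j) |
           (\<gamma> :: nat) (a :: nat \<Rightarrow> nat). \<forall>j<\<gamma>. a j \<in> {0, 1}}"

text \<open>On the second countable, \<open>\<sigma>\<close>-compact group \<open>\<rat>\<^sub>2\<close> a Borel measure that is finite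
  on compact sets is automatically regular, so regularity is not listed.\<close>

definition normalized_haar :: "Q2 measure \<Rightarrow> bool" where
  "normalized_haar M \<longleftrightarrow>
     sets M = sets borel \<and>
     (\<forall>K. compact K \<longrightarrow> emeasure M K < \<infinity>) \<and>
     (\<forall>a. \<forall>A\<in>sets M. emeasure M ((\<lambda>x. a + x) ` A) = emeasure M A) \<and>
     emeasure M Z2 = 1"


section \<open>Square-integrable functions\<close>

text \<open>Elements of \<open>L\<^sup>2(M)\<close> are represented by functions rather than by their classes modulo
  almost-everywhere equality. Every closed set below is closed for the \<open>L\<^sup>2\<close> seminorm, hence
  saturated under almost-everywhere equality. The closure is only meaningful for subsets of
  \<open>L\<^sup>2(M)\<close>, since the integral of a non-integrable function is 0 by convention.\<close>

definition L2 :: "'a measure \<Rightarrow> ('a \<Rightarrow> complex) set" where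
  "L2 M = {f \<in> borel_measurable M. integrable M (\<lambda>x. (cmod (f x))\<^sup>2)}"

definition l2_inner :: "'a measure \<Rightarrow> ('a \<Rightarrow> complex) \<Rightarrow> ('a \<Rightarrow> complex) \<Rightarrow> complex" where
  "l2_inner M f g = (LINT x|M. f x * cnj (g x))"

definition l2_norm :: "'a measure \<Rightarrow> ('a \<Rightarrow> complex) \<Rightarrow> real" where
  "l2_norm M f = sqrt (LINT x|M. (cmod (f x))\<^sup>2)"

definition l2_closure :: "'a measure \<Rightarrow> ('a \<Rightarrow> complex) set \<Rightarrow> ('a \<Rightarrow> complex) set" where
  "l2_closure M S = {f \<in> L2 M. \<forall>\<epsilon>>0. \<exists>g\<in>S. l2_norm M (\<lambda>x. f x - g x) < \<epsilon>}"

global_interpretation cfun: vector_space "\<lambda>(c :: complex) (f :: 'a \<Rightarrow> complex) x. c * f x"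
  by unfold_locales (simp_all add: fun_eq_iff distrib_left distrib_right)

definition closed_subspace :: "'a measure \<Rightarrow> ('a \<Rightarrow> complex) set \<Rightarrow> bool" where
  "closed_subspace M V \<longleftrightarrow> V \<subseteq> L2 M \<and> cfun.subspace V \<and> l2_closure M V \<subseteq> V"

definition closed_span :: "'a measure \<Rightarrow> ('a \<Rightarrow> complex) set \<Rightarrow> ('a \<Rightarrow> complex) set" where
  "closed_span M S = l2_closure M (cfun.span S)"

definition orthonormal_basis ::
  "'a measure \<Rightarrow> ('a \<Rightarrow> complex) set \<Rightarrow> 'i set \<Rightarrow> ('i \<Rightarrow> 'a \<Rightarrow> complex) \<Rightarrow> bool" where
  "orthonormal_basis M V I e \<longleftrightarrow>
     (\<forall>i\<in>I. e i \<in> V) \<and>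
     (\<forall>i\<in>I. \<forall>j\<in>I. l2_inner M (e i) (e j) = (if i = j then 1 else 0)) \<and>
     closed_span M (e ` I) = V"


section \<open>Multiresolution analyses and wavelet functions\<close>

definition refinable :: "Q2 measure \<Rightarrow> (int \<Rightarrow> (Q2 \<Rightarrow> complex) set) \<Rightarrow> (Q2 \<Rightarrow> complex) \<Rightarrow> bool" where
  "refinable M V \<phi> \<longleftrightarrow>
     \<phi> \<in> V 0 \<and> orthonormal_basis M (V 0) I2 (\<lambda>a x. \<phi> (x - a))"

definition is_MRA :: "Q2 measure \<Rightarrow> (int \<Rightarrow> (Q2 \<Rightarrow> complex) set) \<Rightarrow> bool" where
  "is_MRA M V \<longleftrightarrow>
     (\<forall>j. closed_subspace M (V j)) \<and>
     (\<forall>j. V j \<subseteq> V (j + 1)) \<and>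
     l2_closure M (\<Union>j. V j) = L2 M \<and>
     (\<Inter>j. V j) = {f \<in> L2 M. AE x in M. f x = 0} \<and>
     (\<forall>j f. f \<in> V j \<longleftrightarrow> (\<lambda>x. f (inverse 2 * x)) \<in> V (j + 1)) \<and>
     (\<exists>\<phi>. refinable M V \<phi>)"

definition wavelet_space :: "Q2 measure \<Rightarrow> (int \<Rightarrow> (Q2 \<Rightarrow> complex) set) \<Rightarrow> (Q2 \<Rightarrow> complex) set" where
  "wavelet_space M V = {f \<in> V 1. \<forall>g\<in>V 0. l2_inner M f g = 0}"

definition wavelet_function ::
  "Q2 measure \<Rightarrow> (int \<Rightarrow> (Q2 \<Rightarrow> complex) set) \<Rightarrow> (Q2 \<Rightarrow> complex) \<Rightarrow> bool" where
  "wavelet_function M V \<psi> \<longleftrightarrow>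
     \<psi> \<in> wavelet_space M V \<and>
     orthonormal_basis M (wavelet_space M V) I2 (\<lambda>a x. \<psi> (x - a))"

end

theory Submission
  imports Defs
begin

text \<open>Every ball of \<open>\<rat>\<^sub>2\<close> of radius \<open>2\<^sup>-\<^sup>j\<close> is a translate \<open>2\<^sup>j (a + \<int>\<^sub>2)\<close> for some \<open>a \<in> I\<^sub>2\<close>,
  so \<open>V\<^sub>j\<close> is the closed span of the indicators of these balls, i.e. the space of square-integrable
  functions constant on them. Nesting holds because each ball splits into two balls of half the
  radius, and density because the balls form a countable, intersection-stable basis of the
  topology, hence generate the Borel sets. A function in all \<open>V\<^sub>j\<close> is constant on arbitrarily large
  balls and hence orthogonal to every ball indicator, thus zero. The translates of \<open>\<psi>\<close>
  are differences of the indicators of the two halves of a unit ball; together with the indicators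
  of unit balls they span \<open>V\<^sub>1\<close>, and they are orthogonal to \<open>V\<^sub>0\<close>.\<close>

section \<open>The absolute value and the digits of 2-adic numbers\<close>

text \<open>The splitting of balls rests on one arithmetic fact: a 2-adic integer is within distance
  1/2 of 0 or of 1. \<open>Q2\<close> consists of classes of rational Cauchy sequences, so this is
  proved for rationals by parity and carried to limits. Translation invariance and the normalisation
  fix the measure of every ball, since the two halves of a ball are translates of each other.
  Analytically, a closed subspace contains a closed span as soon as it contains the generators. The
  vectors orthogonal to a fixed function form a closed subspace, so orthogonality is also tested on
  ball indicators only; a function orthogonal to all of them is orthogonal to itself. In the
  intersection argument, enlarging a ball to level -k costs a factor \<open>2 ^ (k/2)\<close> in the
  norm but gains \<open>2 ^ (-k)\<close> from constancy. Spanning of the wavelet space is read off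
  from approximants: if f in W_0 is close to g0 + g1, with g0 in V_0 and g1 a combination of
  wavelets, then f - g1 is orthogonal to g0, and omitting g0 does not increase the error.\<close>

lemma padic_cauchy_abs_tendsto:
  assumes "prime p" "padic_cauchy p X"
  shows "(\<lambda>n. padic_abs p (X n)) \<longlonglongrightarrow> lim (\<lambda>n. padic_abs p (X n))"
  using padic_cauchy_abs_convergent[OF assms] by (simp only: convergent_LIMSEQ_iff)

lemma Q2_abs_mult: "Q2_abs (x * y) = Q2_abs x * Q2_abs y"
proof transfer
  fix X Y assume "padic_rel 2 X X" "padic_rel 2 Y Y"
  then have X: "padic_cauchy 2 X" and Y: "padic_cauchy 2 Y" by (simp_all add: padic_rel_def)
  have "(\<lambda>n. padic_abs 2 (X n) * padic_abs 2 (Y n)) \<longlonglongrightarrow>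
      lim (\<lambda>n. padic_abs 2 (X n)) * lim (\<lambda>n. padic_abs 2 (Y n))"
    by (intro tendsto_mult padic_cauchy_abs_tendsto X Y two_prime_nat)
  then show "lim (\<lambda>n. padic_abs 2 (X n * Y n)) =
      lim (\<lambda>n. padic_abs 2 (X n)) * lim (\<lambda>n. padic_abs 2 (Y n))"
    by (simp add: padic_abs_mult limI)
qed

lemma Q2_abs_add_le_max: "Q2_abs (x + y) \<le> max (Q2_abs x) (Q2_abs y)"
proof transfer
  fix X Y assume "padic_rel 2 X X" "padic_rel 2 Y Y"
  then have X: "padic_cauchy 2 X" and Y: "padic_cauchy 2 Y" by (simp_all add: padic_rel_def)
  note lim = padic_cauchy_abs_tendsto[OF two_prime_nat]
  show "lim (\<lambda>n. padic_abs 2 (X n + Y n)) \<le>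
      max (lim (\<lambda>n. padic_abs 2 (X n))) (lim (\<lambda>n. padic_abs 2 (Y n)))"
    by (rule LIMSEQ_le[OF lim[OF padic_cauchy_add[OF two_prime_nat X Y]]
          tendsto_max[OF lim[OF X] lim[OF Y]]]) (simp add: padic_abs_add_le_max)
qed

lemma Q2_abs_nonneg [simp]: "Q2_abs x \<ge> 0"
proof transfer
  fix X assume "padic_rel 2 X X"
  then have X: "padic_cauchy 2 X" by (simp add: padic_rel_def)
  show "0 \<le> lim (\<lambda>n. padic_abs 2 (X n))"
    using padic_cauchy_abs_tendsto[OF two_prime_nat X]
    by (rule tendsto_lowerbound) simp_all
qed

lemma Q2_abs_0 [simp]: "Q2_abs 0 = 0"
  by (simp add: Q2_abs_eq_0_iff)

lemma Q2_abs_1 [simp]: "Q2_abs 1 = 1"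
  by transfer (simp add: limI)

lemma padic_abs_2_2: "padic_abs 2 2 = 1 / 2"
proof -
  have "multiplicity (int 2) 1 = 0" "multiplicity (int 2) 2 = 1"
    by simp_all
  then show ?thesis
    using padic_abs_fraction[of 2 2 1] by (simp add: power_int_minus)
qed

lemma Q2_abs_2 [simp]: "Q2_abs 2 = 1 / 2"
proof -
  have "Q2_abs (1 + 1) = 1 / 2"
    by transfer (simp add: padic_abs_2_2 limI)
  then show ?thesis by simp
qed

lemma Q2_two_neq_0 [simp]: "(2 :: Q2) \<noteq> 0"
  using Q2_abs_2 Q2_abs_eq_0_iff[of 2] by auto

lemma Q2_abs_inverse: "Q2_abs (inverse x) = inverse (Q2_abs x)"
proof (cases "x = 0")
  case False
  then show ?thesis
    using Q2_abs_mult[of x "inverse x"] by (simp add: Q2_abs_eq_0_iff field_simps)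
qed simp

lemma Q2_abs_divide: "Q2_abs (x / y) = Q2_abs x / Q2_abs y"
  by (simp add: divide_inverse Q2_abs_mult Q2_abs_inverse)

lemma Q2_abs_power: "Q2_abs (x ^ n) = Q2_abs x ^ n"
  by (induction n) (simp_all add: Q2_abs_mult)

lemma Q2_abs_2_powi [simp]: "Q2_abs (2 powi n) = 2 powi (- n)"
  by (cases "n \<ge> 0")
    (simp_all add: power_int_def Q2_abs_power Q2_abs_divide)

lemma Q2_abs_diff_commute: "Q2_abs (x - y) = Q2_abs (y - x)"
  using Q2_abs_minus[of "x - y"] by simp

lemma Q2_abs_diff_le_max: "Q2_abs (x - y) \<le> max (Q2_abs x) (Q2_abs y)"
  using Q2_abs_add_le_max[of x "- y"] by (simp add: Q2_abs_minus)

lemma Q2_abs_of_nat_le_1: "Q2_abs (of_nat n) \<le> 1"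
proof (induction n)
  case (Suc n)
  then show ?case
    using Q2_abs_add_le_max[of 1 "of_nat n"] by simp
qed simp

text \<open>Write n = 2m + 1. If n had absolute value below 1, then 1 = n - 2m would too by the
  ultrametric inequality, because 2m has absolute value at most 1/2.\<close>

lemma Q2_abs_of_nat_odd:
  assumes "odd n"
  shows "Q2_abs (of_nat n) = 1"
proof (rule ccontr)
  assume "Q2_abs (of_nat n) \<noteq> 1"
  then have lt: "Q2_abs (of_nat n) < 1"
    using Q2_abs_of_nat_le_1[of n] by simp
  obtain m where n: "n = 2 * m + 1"
    using assms by (rule oddE)
  have "Q2_abs (2 * of_nat m) \<le> 1 / 2"
    using Q2_abs_of_nat_le_1[of m] by (simp add: Q2_abs_mult)
  moreover have "Q2_abs 1 \<le> max (Q2_abs (of_nat n)) (Q2_abs (2 * of_nat m))"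
    using Q2_abs_diff_le_max[of "of_nat n" "2 * of_nat m"] n by simp
  ultimately show False using lt by simp
qed

text \<open>A positive number below \<open>2 ^ n\<close> is not divisible by \<open>2 ^ n\<close>.
  Halving an even k lowers n by one, and an odd k has absolute value 1. This is what separates
  distinct elements of \<open>I2\<close>.\<close>

lemma Q2_abs_of_nat_gt:
  assumes "0 < k" "k < 2 ^ n"
  shows "Q2_abs (of_nat k) > 1 / 2 ^ n"
  using assms
proof (induction n arbitrary: k)
  case (Suc n)
  show ?case
  proof (cases "odd k")
    case True
    have "(1 :: real) < 2 * 2 ^ n"
      using one_le_power[of "2 :: real" n] by linarith
    then show ?thesis
      using True by (simp add: Q2_abs_of_nat_odd)
  next
    case False
    then obtain m where k: "k = 2 * m" by auto
    then have "1 / 2 ^ n < Q2_abs (of_nat m)"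
      using Suc by simp
    then show ?thesis
      using k by (simp add: Q2_abs_mult)
  qed
qed simp

section \<open>Binary digits of 2-adic integers\<close>

text \<open>In lowest terms a / b, the bound forces b to be odd, and then a or a - b is even. The
  strict bound 2 is chosen because a Cauchy sequence whose absolute values tend to a limit at most 1
  satisfies it eventually, although its terms need not be bounded by 1.\<close>

lemma padic_abs_2_digit:
  assumes "padic_abs 2 r < 2"
  shows "padic_abs 2 r \<le> 1 / 2 \<or> padic_abs 2 (r - 1) \<le> 1 / 2"
proof -
  obtain a b where ab: "quotient_of r = (a, b)" by (cases "quotient_of r")
  have b: "b > 0" using ab by (rule quotient_of_denom_pos)
  have r: "r = of_int a / of_int b" using ab by (rule quotient_of_div)
  have cop: "coprime a b" using ab by (rule quotient_of_coprime)
  have even_mult: "1 \<le> multiplicity 2 k" if "even k" "k \<noteq> 0" for k :: int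
    using that by (intro multiplicity_geI) auto
  have odd_mult: "multiplicity 2 k = 0" if "odd k" for k :: int
    using that by (rule not_dvd_imp_multiplicity_0)
  have small: "padic_abs 2 (of_int k / of_int b) \<le> 1 / 2" if "even k" "odd b" for k
  proof (cases "k = 0")
    case False
    have "padic_abs 2 (of_int k / of_int b) = 2 powi (- int (multiplicity 2 k))"
      using padic_abs_fraction[of 2 k b] False b odd_mult[OF that(2)] by simp
    also have "\<dots> \<le> 2 powi (- 1)"
      using even_mult[OF that(1) False] by (intro power_int_increasing) auto
    finally show ?thesis by (simp add: power_int_minus)
  qed simp
  have "odd b"
  proof
    assume "even b"
    then have "odd a" using cop by (metis coprime_common_divisor odd_one)
    then have "a \<noteq> 0" by auto
    \<comment> \<open>An even denominator with an odd numerator gives absolute value at least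
      2.\<close>
    have "2 powi 1 \<le> (2 :: real) powi (int (multiplicity 2 b))"
      using even_mult[OF \<open>even b\<close>] b by (intro power_int_increasing) auto
    also have "\<dots> = padic_abs 2 r"
      using padic_abs_fraction[of 2 a b] \<open>a \<noteq> 0\<close> b odd_mult[OF \<open>odd a\<close>] r by simp
    finally show False using assms by simp
  qed
  show ?thesis
  proof (cases "even a")
    case True
    then show ?thesis using small[of a] \<open>odd b\<close> r by simp
  next
    case False
    have "r - 1 = of_int (a - b) / of_int b"
      using r b by (simp add: field_simps)
    then show ?thesis using small[of "a - b"] \<open>odd b\<close> False by simp
  qed
qed

lemma Z2_digit:
  assumes "x \<in> Z2"
  shows "\<exists>d \<in> {0, 1}. Q2_abs (x - of_nat d) \<le> 1 / 2"
proof -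
  have "Q2_abs x \<le> 1 \<Longrightarrow> Q2_abs x \<le> 1 / 2 \<or> Q2_abs (x - 1) \<le> 1 / 2"
    \<comment> \<open>Subtraction on \<open>Q2\<close> is defined through addition and negation and
      is not itself lifted, so it is rewritten before the transfer to sequences.\<close>
    unfolding diff_conv_add_uminus
  proof transfer
    fix X assume "padic_rel 2 X X" and le: "lim (\<lambda>n. padic_abs 2 (X n)) \<le> 1"
    then have X: "padic_cauchy 2 X" by (simp add: padic_rel_def)
    have X1: "padic_cauchy 2 (\<lambda>n. X n + - 1)"
      by (intro padic_cauchy_add X padic_cauchy_const two_prime_nat)
    note lim = padic_cauchy_abs_tendsto[OF two_prime_nat]
    have ev: "\<forall>\<^sub>F n in sequentially. padic_abs 2 (X n) < 2"
      using order_tendstoD(2)[OF lim[OF X], of 2] le by simp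
    show "lim (\<lambda>n. padic_abs 2 (X n)) \<le> 1 / 2 \<or> lim (\<lambda>n. padic_abs 2 (X n + - 1)) \<le> 1 / 2"
    \<comment> \<open>The digit may vary with n. If digit 0 fits infinitely often, the limit of the
      absolute values cannot exceed 1/2; otherwise digit 1 fits for all large n.\<close>
    proof (cases "\<exists>\<^sub>F n in sequentially. padic_abs 2 (X n) \<le> 1 / 2")
      case True
      have "\<not> lim (\<lambda>n. padic_abs 2 (X n)) > 1 / 2"
      proof
        assume "lim (\<lambda>n. padic_abs 2 (X n)) > 1 / 2"
        then have "\<forall>\<^sub>F n in sequentially. padic_abs 2 (X n) > 1 / 2"
          using order_tendstoD(1)[OF lim[OF X]] by blast
        then show False
          using True by (auto simp: frequently_def not_le)
      qed
      then show ?thesis by simp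
    next
      case False
      then have "\<forall>\<^sub>F n in sequentially. \<not> padic_abs 2 (X n) \<le> 1 / 2"
        by (simp add: frequently_def)
      with ev have "\<forall>\<^sub>F n in sequentially. padic_abs 2 (X n + - 1) \<le> 1 / 2"
        by eventually_elim (use padic_abs_2_digit in force)
      then have "lim (\<lambda>n. padic_abs 2 (X n + - 1)) \<le> 1 / 2"
        using lim[OF X1] by (intro tendsto_upperbound) auto
      then show ?thesis ..
    qed
  qed
  then show ?thesis
    using assms by (auto simp: Z2_def)
qed

text \<open>The binary expansion truncated after k digits, built one digit at a time.\<close>

lemma Z2_approx:
  assumes "x \<in> Z2"
  shows "\<exists>n < 2 ^ k. Q2_abs (x - of_nat n) \<le> 1 / 2 ^ k"
proof (induction k)
  case 0
  then show ?case using assms by (simp add: Z2_def)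
next
  case (Suc k)
  then obtain n where n: "n < 2 ^ k" "Q2_abs (x - of_nat n) \<le> 1 / 2 ^ k" by blast
  \<comment> \<open>The rescaled remainder is again a 2-adic integer, and its first digit is the
    next digit of x.\<close>
  define z where "z = (x - of_nat n) / 2 ^ k"
  have xz: "x - of_nat n = 2 ^ k * z" by (simp add: z_def)
  then have "z \<in> Z2"
    using n(2) by (simp add: Z2_def Q2_abs_mult Q2_abs_power power_one_over field_simps)
  then obtain d where d: "d \<in> {0, 1}" "Q2_abs (z - of_nat d) \<le> 1 / 2"
    using Z2_digit by blast
  have "x - of_nat (n + 2 ^ k * d) = 2 ^ k * (z - of_nat d)"
    using xz by (simp add: algebra_simps)
  then have "Q2_abs (x - of_nat (n + 2 ^ k * d)) = 1 / 2 ^ k * Q2_abs (z - of_nat d)"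
    by (simp only: Q2_abs_mult Q2_abs_power Q2_abs_2 power_one_over)
  also have "\<dots> \<le> 1 / 2 ^ Suc k"
    using d(2) by (simp add: divide_right_mono field_simps)
  finally have "Q2_abs (x - of_nat (n + 2 ^ k * d)) \<le> 1 / 2 ^ Suc k" .
  moreover have "n + 2 ^ k * d < 2 ^ Suc k"
    using n(1) d(1) by auto
  ultimately show ?case by blast
qed

text \<open>Replaces the digit sequences in the definition of \<open>I2\<close> by a single
  numerator, so that two representatives can be put over a common denominator.\<close>

lemma binary_digits:
  "(\<exists>a. (\<forall>j<k. a j \<in> {0, 1 :: nat}) \<and> n = (\<Sum>j<k. a j * 2 ^ j)) \<longleftrightarrow> n < 2 ^ k"
proof
  assume "\<exists>a. (\<forall>j<k. a j \<in> {0, 1 :: nat}) \<and> n = (\<Sum>j<k. a j * 2 ^ j)"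
  then obtain a where a: "\<forall>j<k. a j \<in> {0, 1 :: nat}" "n = (\<Sum>j<k. a j * 2 ^ j)" by blast
  have "n \<le> (\<Sum>j<k. 2 ^ j)"
    unfolding a(2) using a(1) by (intro sum_mono) auto
  also have "\<dots> < 2 ^ k"
    by (induction k) auto
  finally show "n < 2 ^ k" .
next
  show "n < 2 ^ k \<Longrightarrow> \<exists>a. (\<forall>j<k. a j \<in> {0, 1 :: nat}) \<and> n = (\<Sum>j<k. a j * 2 ^ j)"
  proof (induction k arbitrary: n)
    case (Suc k)
    obtain a where a: "\<forall>j<k. a j \<in> {0, 1 :: nat}" "n mod 2 ^ k = (\<Sum>j<k. a j * 2 ^ j)"
      using Suc.IH[of "n mod 2 ^ k"] by auto
    have "n div 2 ^ k < 2"
      using Suc.prems by (simp add: less_mult_imp_div_less)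
    moreover have "n = (\<Sum>j<k. a j * 2 ^ j) + n div 2 ^ k * 2 ^ k"
      by (metis a(2) mod_div_mult_eq)
    ultimately show ?case
      \<comment> \<open>The quotient by \<open>2 ^ k\<close> is the leading digit; the digits of the
        remainder come from the induction hypothesis.\<close>
      using a(1) by (intro exI[of _ "a(k := n div 2 ^ k)"]) (auto simp: less_Suc_eq)
  qed simp
qed

section \<open>Representatives of the 2-adic numbers modulo the 2-adic integers\<close>

lemma I2_altdef: "I2 = {of_nat n / 2 ^ k | n k. n < 2 ^ k}"
proof -
  have eq: "2 powi (- int k) * (\<Sum>j<k. of_nat (a j) * 2 ^ j) =
      (of_nat (\<Sum>j<k. a j * 2 ^ j) / 2 ^ k :: Q2)" for k and a :: "nat \<Rightarrow> nat"
    by (simp add: power_int_minus field_simps)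
  show ?thesis
    unfolding I2_def binary_digits[symmetric] eq by blast
qed

lemma countable_I2: "countable I2"
proof -
  have "I2 \<subseteq> range (\<lambda>(n :: nat, k :: nat). of_nat n / 2 ^ k)"
    by (auto simp: I2_altdef)
  then show ?thesis
    by (rule countable_subset) simp
qed

text \<open>Multiply x by a power \<open>2 ^ k\<close> that brings it into \<open>Z2\<close>,
  truncate to k digits, and divide back: the error \<open>1 / 2 ^ k\<close> becomes at most
  1.\<close>

lemma I2_representative: "\<exists>a \<in> I2. Q2_abs (x - a) \<le> 1"
proof -
  obtain k where "Q2_abs x < 2 ^ k"
    using real_arch_pow[of 2 "Q2_abs x"] by auto
  then have "2 ^ k * x \<in> Z2"
    by (simp add: Z2_def Q2_abs_mult Q2_abs_power power_one_over field_simps)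
  then obtain n where n: "n < 2 ^ k" "Q2_abs (2 ^ k * x - of_nat n) \<le> 1 / 2 ^ k"
    using Z2_approx by blast
  have "2 ^ k * x - of_nat n = 2 ^ k * (x - of_nat n / 2 ^ k)"
    by (simp add: algebra_simps)
  then have "Q2_abs (2 ^ k * x - of_nat n) = 1 / 2 ^ k * Q2_abs (x - of_nat n / 2 ^ k)"
    by (simp only: Q2_abs_mult Q2_abs_power Q2_abs_2 power_one_over)
  then have "Q2_abs (x - of_nat n / 2 ^ k) \<le> 1"
    using n(2) by (simp add: divide_le_cancel)
  then show ?thesis
    using n(1) by (auto simp: I2_altdef)
qed

text \<open>Over the common denominator \<open>2 ^ (k + l)\<close> the numerators lie below that
  power, and their difference is divisible by it only if they agree.\<close>

lemma I2_unique:
  assumes "a \<in> I2" "b \<in> I2" "Q2_abs (a - b) \<le> 1"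
  shows "a = b"
proof -
  obtain n k where a: "a = of_nat n / 2 ^ k" "n < 2 ^ k" using assms(1) by (auto simp: I2_altdef)
  obtain m l where b: "b = of_nat m / 2 ^ l" "m < 2 ^ l" using assms(2) by (auto simp: I2_altdef)
  define N K where "N = n * 2 ^ l" and "K = m * 2 ^ k"
  have N: "N < 2 ^ (k + l)" and K: "K < 2 ^ (k + l)"
    using a b by (simp_all add: N_def K_def power_add mult.commute)
  have aN: "a = of_nat N / 2 ^ (k + l)" and bK: "b = of_nat K / 2 ^ (k + l)"
    using a b by (simp_all add: N_def K_def power_add)
  have "of_nat N - of_nat K = 2 ^ (k + l) * (a - b)"
    by (simp add: aN bK right_diff_distrib)
  then have "Q2_abs (of_nat N - of_nat K) = 1 / 2 ^ (k + l) * Q2_abs (a - b)"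
    by (simp only: Q2_abs_mult Q2_abs_power Q2_abs_2 power_one_over)
  then have le: "Q2_abs (of_nat N - of_nat K) \<le> 1 / 2 ^ (k + l)"
    using assms(3) by (simp add: divide_le_cancel)
  have neq: "\<not> i < j" if "j < 2 ^ (k + l)" "Q2_abs (of_nat j - of_nat i) \<le> 1 / 2 ^ (k + l)" for i j
  proof
    assume "i < j"
    then show False
      using Q2_abs_of_nat_gt[of "j - i" "k + l"] that by (auto simp: of_nat_diff less_imp_diff_less)
  qed
  have "N = K"
    using neq[OF N le] neq[OF K, of N] le Q2_abs_diff_commute[of "of_nat N" "of_nat K"]
    by linarith
  then show ?thesis using aN bK by simp
qed

section \<open>Balls and Haar measure\<close>

lemma two_powi_minus_Suc: "(2 :: real) powi (- (n + 1)) = 2 powi (- n) / 2"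
  using power_int_add[of "2 :: real" "- n" "- 1"] by (simp add: power_int_minus)

text \<open>This is the coset of c modulo \<open>2 powi n\<close> times \<open>Z2\<close>. Larger n
  means a smaller ball, so that the level of a ball matches the index of the space V_j that it
  generates.\<close>

definition Q2_ball :: "int \<Rightarrow> Q2 \<Rightarrow> Q2 set" where
  "Q2_ball n c = {x. Q2_abs (x - c) \<le> 2 powi (- n)}"

lemma Z2_eq_ball: "Z2 = Q2_ball 0 0"
  by (simp add: Z2_def Q2_ball_def)

lemma Q2_ball_eq_cball: "Q2_ball n c = cball c (2 powi (- n))"
  by (auto simp: Q2_ball_def dist_Q2_def Q2_abs_diff_commute)

lemma center_in_Q2_ball [simp]: "c \<in> Q2_ball n c"
  by (simp add: Q2_ball_def)

lemma Q2_ball_mono: "m \<le> n \<Longrightarrow> Q2_ball n c \<subseteq> Q2_ball m c"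
  using power_int_increasing[of "- n" "- m" "2 :: real"] by (auto simp: Q2_ball_def)

lemma Q2_ball_commute: "x \<in> Q2_ball n c \<longleftrightarrow> c \<in> Q2_ball n x"
  by (simp add: Q2_ball_def Q2_abs_diff_commute)

lemma Q2_ball_trans: "x \<in> Q2_ball n y \<Longrightarrow> y \<in> Q2_ball n z \<Longrightarrow> x \<in> Q2_ball n z"
  using Q2_abs_add_le_max[of "x - y" "y - z"] by (simp add: Q2_ball_def)

lemma Q2_ball_recenter:
  assumes "x \<in> Q2_ball n c"
  shows "Q2_ball n c = Q2_ball n x"
  using assms Q2_ball_trans Q2_ball_commute by blast

text \<open>Every point of an ultrametric ball is a centre, so two balls that meet can be recentred
  at a common point.\<close>

lemma Q2_ball_nested:
  assumes "m \<le> n" "Q2_ball n c \<inter> Q2_ball m d \<noteq> {}"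
  shows "Q2_ball n c \<subseteq> Q2_ball m d"
proof -
  obtain x where x: "x \<in> Q2_ball n c" "x \<in> Q2_ball m d" using assms(2) by blast
  show ?thesis
    using Q2_ball_mono[OF assms(1), of x] Q2_ball_recenter[OF x(1)] Q2_ball_recenter[OF x(2)]
    by simp
qed

lemma Q2_ball_disjoint: "Q2_ball n c \<noteq> Q2_ball n d \<Longrightarrow> Q2_ball n c \<inter> Q2_ball n d = {}"
  using Q2_ball_nested[of n n c d] Q2_ball_nested[of n n d c] by blast

text \<open>Multiplication by \<open>2 powi k\<close> scales distances by
  \<open>2 powi (- k)\<close>, so the preimage of a ball moves k levels towards larger
  balls.\<close>

lemma Q2_ball_dilate: "2 powi k * x \<in> Q2_ball n c \<longleftrightarrow> x \<in> Q2_ball (n - k) (2 powi (- k) * c)"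
proof -
  have "2 powi k * x - c = 2 powi k * (x - 2 powi (- k) * c)"
    by (simp add: right_diff_distrib power_int_minus field_simps)
  then have "Q2_abs (2 powi k * x - c) = 2 powi (- k) * Q2_abs (x - 2 powi (- k) * c)"
    by (simp only: Q2_abs_mult Q2_abs_2_powi)
  moreover have "(2 :: real) powi (- n) = 2 powi (- k) * 2 powi (- (n - k))"
    by (simp flip: power_int_add)
  ultimately have "Q2_abs (2 powi k * x - c) \<le> 2 powi (- n) \<longleftrightarrow>
      Q2_abs (x - 2 powi (- k) * c) \<le> 2 powi (- (n - k))"
    by (simp only: mult_le_cancel_left_pos zero_less_power_int zero_less_numeral)
  then show ?thesis
    by (simp add: Q2_ball_def)
qed

lemma Q2_ball_translate: "x - b \<in> Q2_ball n c \<longleftrightarrow> x \<in> Q2_ball n (c + b)"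
  by (simp add: Q2_ball_def algebra_simps)

lemma Q2_ball_translate_image: "(+) b ` Q2_ball n c = Q2_ball n (b + c)"
proof -
  have "x \<in> (+) b ` Q2_ball n c \<longleftrightarrow> x - b \<in> Q2_ball n c" for x
    by (force simp: image_iff algebra_simps)
  then show ?thesis
    by (auto simp: Q2_ball_translate add.commute)
qed

text \<open>The first binary digit of (x - c) / \<open>2 powi n\<close> decides in which half x
  lies.\<close>

lemma Q2_ball_split:
  "Q2_ball n c = Q2_ball (n + 1) c \<union> Q2_ball (n + 1) (c + 2 powi n)"
  "Q2_ball (n + 1) c \<inter> Q2_ball (n + 1) (c + 2 powi n) = {}"
proof -
  note half = two_powi_minus_Suc[of n]
  have pos: "(0 :: real) < 2 powi (- n)" by simp
  show "Q2_ball n c = Q2_ball (n + 1) c \<union> Q2_ball (n + 1) (c + 2 powi n)"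
  proof (intro equalityI subsetI)
    fix x assume "x \<in> Q2_ball n c"
    define z where "z = 2 powi (- n) * (x - c)"
    have x: "x = c + 2 powi n * z"
      by (simp add: z_def power_int_minus field_simps)
    have "z \<in> Z2"
      using \<open>x \<in> Q2_ball n c\<close> mult_left_mono[of "Q2_abs (x - c)" "2 powi (- n)" "2 powi n"]
      by (simp add: z_def Z2_def Q2_ball_def Q2_abs_mult flip: power_int_add)
    then consider "Q2_abs z \<le> 1 / 2" | "Q2_abs (z - 1) \<le> 1 / 2"
      using Z2_digit[of z] by auto
    then show "x \<in> Q2_ball (n + 1) c \<union> Q2_ball (n + 1) (c + 2 powi n)"
    proof cases
      case 1
      have "Q2_abs (x - c) = 2 powi (- n) * Q2_abs z"
        by (simp add: x Q2_abs_mult)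
      also have "\<dots> \<le> 2 powi (- (n + 1))"
        unfolding half using 1 mult_left_mono[OF 1 less_imp_le[OF pos]] by simp
      finally show ?thesis by (simp add: Q2_ball_def)
    next
      case 2
      have "x - (c + 2 powi n) = 2 powi n * (z - 1)"
        by (simp add: x algebra_simps)
      then have "Q2_abs (x - (c + 2 powi n)) = 2 powi (- n) * Q2_abs (z - 1)"
        by (simp only: Q2_abs_mult Q2_abs_2_powi)
      also have "\<dots> \<le> 2 powi (- (n + 1))"
        unfolding half using mult_left_mono[OF 2 less_imp_le[OF pos]] by simp
      finally show ?thesis by (simp add: Q2_ball_def)
    qed
  next
    have "c + 2 powi n \<in> Q2_ball n c"
      by (simp add: Q2_ball_def)
    then show "x \<in> Q2_ball n c" if "x \<in> Q2_ball (n + 1) c \<union> Q2_ball (n + 1) (c + 2 powi n)" for x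
      using that Q2_ball_mono[of n "n + 1"] Q2_ball_recenter[of "c + 2 powi n" n c] by auto
  qed
  \<comment> \<open>The two centres are at distance exactly \<open>2 powi (- n)\<close>, twice the
    new radius; distinct balls of equal radius are disjoint.\<close>
  have "c + 2 powi n \<notin> Q2_ball (n + 1) c"
    using pos unfolding Q2_ball_def half by simp
  then have "Q2_ball (n + 1) c \<noteq> Q2_ball (n + 1) (c + 2 powi n)"
    by auto
  then show "Q2_ball (n + 1) c \<inter> Q2_ball (n + 1) (c + 2 powi n) = {}"
    by (rule Q2_ball_disjoint)
qed

lemma Q2_ball_representative: "\<exists>a \<in> I2. Q2_ball n c = Q2_ball n (2 powi n * a)"
proof -
  obtain a where a: "a \<in> I2" "Q2_abs (2 powi (- n) * c - a) \<le> 1"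
    using I2_representative by blast
  have "2 powi (- n) * c \<in> Q2_ball 0 a"
    using a(2) by (simp add: Q2_ball_def)
  then have "c \<in> Q2_ball n (2 powi n * a)"
    by (simp add: Q2_ball_dilate)
  then show ?thesis
    using a(1) Q2_ball_recenter by blast
qed

section \<open>Balls as a generator of the topology and of the Borel sets\<close>

lemma open_Q2_ball: "open (Q2_ball n c)"
  unfolding open_dist
proof
  fix x assume "x \<in> Q2_ball n c"
  then have "Q2_ball n c = cball x (2 powi (- n))"
    by (metis Q2_ball_recenter Q2_ball_eq_cball)
  then show "\<exists>e>0. \<forall>y. dist y x < e \<longrightarrow> y \<in> Q2_ball n c"
    by (intro exI[of _ "2 powi (- n)"]) (auto simp: dist_commute)
qed

text \<open>Up to equality of balls, the centre may be taken in the countable set \<open>I2\<close>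
  scaled by \<open>2 powi n\<close>.\<close>

lemma countable_Q2_balls: "countable {Q2_ball n c | n c. True}"
proof -
  have "{Q2_ball n c | n c. True} \<subseteq> (\<lambda>(n, a). Q2_ball n (2 powi n * a)) ` (UNIV \<times> I2)"
    using Q2_ball_representative by fastforce
  then show ?thesis
    by (rule countable_subset) (intro countable_image countable_SIGMA countable_I2 countableI_type)
qed

lemma Q2_ball_basis: "topological_basis {Q2_ball n c | n c. True}"
proof (rule topological_basisI)
  fix U and x :: Q2
  assume "open U" "x \<in> U"
  then obtain e where e: "e > 0" "ball x e \<subseteq> U"
    by (auto simp: open_contains_ball)
  obtain n where "(1 / 2) ^ n < e"
    using real_arch_pow_inv[of e "1 / 2"] e(1) by auto
  then have "Q2_ball (int n) x \<subseteq> ball x e"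
    by (auto simp: Q2_ball_eq_cball power_int_minus power_one_over inverse_eq_divide)
  then show "\<exists>B\<in>{Q2_ball n c | n c. True}. x \<in> B \<and> B \<subseteq> U"
    using e(2) center_in_Q2_ball by blast
qed (use open_Q2_ball in blast)

text \<open>The empty set is added because disjoint balls have empty intersection; with it the
  generator is intersection-stable and uniqueness and induction principles for generated
  sigma-algebras apply.\<close>

lemma sets_borel_Q2: "sets borel = sigma_sets UNIV (insert {} {Q2_ball n c | n c. True})"
proof -
  have "topological_basis (insert {} {Q2_ball n c | n c. True})"
    using Q2_ball_basis open_empty
    by (smt (verit, best) insert_iff topological_basis_iff topological_basis_open)
  then have eq: "(borel :: Q2 measure) = sigma UNIV (insert {} {Q2_ball n c | n c. True})"
    using countable_Q2_balls by (intro borel_eq_countable_basis) auto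
  show ?thesis
    by (subst eq) (rule sets_measure_of, simp)
qed

lemma Int_stable_Q2_balls: "Int_stable (insert {} {Q2_ball n c | n c. True})"
proof (rule Int_stableI)
  fix A B assume "A \<in> insert {} {Q2_ball n c | n c. True}" "B \<in> insert {} {Q2_ball n c | n c. True}"
  then consider "A \<inter> B = {}" | n c m d where "A = Q2_ball n c" "B = Q2_ball m d" "A \<inter> B \<noteq> {}"
    by blast
  then show "A \<inter> B \<in> insert {} {Q2_ball n c | n c. True}"
  proof cases
    case (2 n c m d)
    have "A \<inter> B = A \<or> A \<inter> B = B"
      using 2 Q2_ball_nested[of n m d c] Q2_ball_nested[of m n c d] by (cases "m \<le> n") auto
    then show ?thesis using 2 by auto
  qed simp
qed

lemma UN_Q2_ball: "(\<Union>n. Q2_ball (- int n) c) = UNIV"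
proof -
  have "\<exists>n. x \<in> Q2_ball (- int n) c" for x
  proof -
    obtain n where "Q2_abs (x - c) < 2 ^ n"
      using real_arch_pow[of 2 "Q2_abs (x - c)"] by auto
    then show ?thesis by (auto simp: Q2_ball_def intro!: exI[of _ n])
  qed
  then show ?thesis by blast
qed

lemma continuous_on_Q2_affine: "continuous_on UNIV (\<lambda>x :: Q2. u * x - a)"
proof -
  have "\<exists>d>0. \<forall>y. dist y x < d \<longrightarrow> dist (u * y - a) (u * x - a) < e" if "e > 0" for x e
  proof (cases "u = 0")
    case True
    then show ?thesis using that by (intro exI[of _ 1]) simp
  next
    case False
    have "dist (u * y - a) (u * x - a) = Q2_abs u * dist y x" for y
      by (simp add: dist_Q2_def flip: Q2_abs_mult right_diff_distrib)
    moreover have "Q2_abs u > 0"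
      using False Q2_abs_eq_0_iff[of u] Q2_abs_nonneg[of u] by linarith
    ultimately show ?thesis
      using that by (intro exI[of _ "e / Q2_abs u"]) (simp add: field_simps)
  qed
  then show ?thesis
    by (auto simp: continuous_on_iff)
qed

section \<open>Haar measure of balls and the effect of dilations\<close>

locale Q2_haar =
  fixes M :: "Q2 measure"
  assumes haar: "normalized_haar M"
begin

lemma sets_M [measurable_cong, simp]: "sets M = sets borel"
  using haar by (simp add: normalized_haar_def)

lemma space_M [simp]: "space M = UNIV"
  using sets_eq_imp_space_eq[OF sets_M] by simp

lemma Q2_ball_sets [measurable]: "Q2_ball n c \<in> sets M"
  by (simp add: open_Q2_ball borel_open)

lemma emeasure_Q2_ball_translate: "emeasure M (Q2_ball n c) = emeasure M (Q2_ball n 0)"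
proof -
  have "emeasure M ((+) c ` Q2_ball n 0) = emeasure M (Q2_ball n 0)"
    using haar Q2_ball_sets by (simp add: normalized_haar_def open_Q2_ball borel_open)
  then show ?thesis
    by (simp add: Q2_ball_translate_image)
qed

text \<open>The two halves of a ball are translates of each other. The centres are independent since
  the measure depends on the level only.\<close>

lemma emeasure_Q2_ball_double: "emeasure M (Q2_ball n c) = 2 * emeasure M (Q2_ball (n + 1) d)"
proof -
  have "emeasure M (Q2_ball n 0) =
      emeasure M (Q2_ball (n + 1) 0) + emeasure M (Q2_ball (n + 1) (0 + 2 powi n))"
    by (subst Q2_ball_split(1)) (intro plus_emeasure[symmetric] Q2_ball_sets Q2_ball_split(2))
  then show ?thesis
    by (simp add: emeasure_Q2_ball_translate[of _ c] emeasure_Q2_ball_translate[of _ d]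
        emeasure_Q2_ball_translate[of _ "2 powi n"] mult_2)
qed

text \<open>The normalisation gives level 0; doubling propagates the value to both positive and
  negative levels.\<close>

lemma emeasure_Q2_ball: "emeasure M (Q2_ball n c) = ennreal (2 powi (- n))"
proof (induction n arbitrary: c rule: int_induct[where k = 0])
  case base
  then show ?case
    using haar emeasure_Q2_ball_translate[of 0 c]
    by (simp add: normalized_haar_def Z2_eq_ball)
next
  case (step1 n)
  have "ennreal (2 powi (- n)) = 2 * emeasure M (Q2_ball (n + 1) c)"
    using step1 emeasure_Q2_ball_double[of n c c] by simp
  moreover have "2 * ennreal (2 powi (- (n + 1))) = ennreal (2 powi (- n))"
    using ennreal_mult'[of 2 "2 powi (- (n + 1))"] by (simp add: two_powi_minus_Suc del: minus_add_distrib)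
  ultimately have "2 * emeasure M (Q2_ball (n + 1) c) = 2 * ennreal (2 powi (- (n + 1)))"
    by simp
  then show ?case
    by (simp only: ennreal_mult_cancel_left) simp
next
  case (step2 n)
  have "emeasure M (Q2_ball (n - 1) c) = 2 * emeasure M (Q2_ball n c)"
    using emeasure_Q2_ball_double[of "n - 1"] by simp
  also have "\<dots> = ennreal (2 powi (- (n - 1)))"
    using two_powi_minus_Suc[of "n - 1"]
    by (simp add: step2 flip: ennreal_numeral ennreal_mult)
  finally show ?case .
qed

lemma measure_Q2_ball: "measure M (Q2_ball n c) = 2 powi (- n)"
  by (simp add: measure_def emeasure_Q2_ball)

lemma measurable_Q2_affine [measurable]: "(\<lambda>x. u * x - a) \<in> measurable M M"
  using borel_measurable_continuous_onI[OF continuous_on_Q2_affine, of u a]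
  by (simp cong: measurable_cong_sets)

text \<open>The change of variables formula for dilations. Both measures agree on balls, which form
  an intersection-stable generator, and are finite on the balls exhausting the space.\<close>

lemma distr_dilate: "distr M M (\<lambda>x. 2 powi k * x) = density M (\<lambda>_. ennreal (2 powi k))"
proof (rule measure_eqI_generator_eq[OF Int_stable_Q2_balls, where \<Omega> = UNIV])
  have meas: "(\<lambda>x. 2 powi k * x) \<in> measurable M M"
    using measurable_Q2_affine[of "2 powi k" 0] by simp
  fix X assume "X \<in> insert {} {Q2_ball n c | n c. True}"
  then consider "X = {}" | n c where "X = Q2_ball n c" by blast
  then show "emeasure (distr M M (\<lambda>x. 2 powi k * x)) X = emeasure (density M (\<lambda>_. ennreal (2 powi k))) X"
  proof cases
    case (2 n c)
    have "(\<lambda>x. 2 powi k * x) -` Q2_ball n c = Q2_ball (n - k) (2 powi (- k) * c)"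
      by (auto simp: Q2_ball_dilate)
    then have "emeasure (distr M M (\<lambda>x. 2 powi k * x)) X = ennreal (2 powi (k - n))"
      using meas by (simp add: 2 emeasure_distr Q2_ball_sets[simplified] emeasure_Q2_ball)
    also have "(2 :: real) powi (k - n) = 2 powi k * 2 powi (- n)"
      by (simp flip: power_int_add)
    finally show ?thesis
      by (simp add: 2 emeasure_density_const Q2_ball_sets[simplified] emeasure_Q2_ball ennreal_mult)
  qed simp
next
  show "range (\<lambda>n. Q2_ball (- int n) 0) \<subseteq> insert {} {Q2_ball n c | n c. True}" by blast
  show "(\<Union>n. Q2_ball (- int n) 0) = UNIV" by (rule UN_Q2_ball)
  have "(\<lambda>x. 2 powi k * x) \<in> measurable M M"
    using measurable_Q2_affine[of "2 powi k" 0] by simp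
  moreover have "(\<lambda>x. 2 powi k * x) -` Q2_ball n c = Q2_ball (n - k) (2 powi (- k) * c)" for n c
    by (auto simp: Q2_ball_dilate)
  ultimately show "emeasure (distr M M (\<lambda>x. 2 powi k * x)) (Q2_ball (- int i) 0) \<noteq> \<infinity>" for i
    by (simp add: emeasure_distr Q2_ball_sets[simplified] emeasure_Q2_ball)
qed (simp_all add: sets_borel_Q2)

end

section \<open>The seminormed space of square-integrable functions\<close>

lemma L2_measurable: "f \<in> L2 M \<Longrightarrow> f \<in> borel_measurable M"
  by (simp add: L2_def)

lemma L2_sq_integrable: "f \<in> L2 M \<Longrightarrow> integrable M (\<lambda>x. (cmod (f x))\<^sup>2)"
  by (simp add: L2_def)

lemma cmod_sum_sq_le: "(cmod (a + b))\<^sup>2 \<le> 2 * (cmod a)\<^sup>2 + 2 * (cmod b)\<^sup>2"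
proof -
  have "(cmod (a + b))\<^sup>2 \<le> (cmod a + cmod b)\<^sup>2"
    by (intro power_mono norm_triangle_ineq) simp
  also have "\<dots> \<le> 2 * (cmod a)\<^sup>2 + 2 * (cmod b)\<^sup>2"
    using sum_squares_ge_zero[of "cmod a - cmod b" 0]
    by (simp add: power2_eq_square algebra_simps)
  finally show ?thesis .
qed

lemma L2_add:
  assumes "f \<in> L2 M" "g \<in> L2 M"
  shows "(\<lambda>x. f x + g x) \<in> L2 M"
proof -
  note [measurable] = L2_measurable[OF assms(1)] L2_measurable[OF assms(2)]
  have "integrable M (\<lambda>x. 2 * (cmod (f x))\<^sup>2 + 2 * (cmod (g x))\<^sup>2)"
    using assms by (intro Bochner_Integration.integrable_add integrable_mult_right L2_sq_integrable)
  then have "integrable M (\<lambda>x. (cmod (f x + g x))\<^sup>2)"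
    by (rule Bochner_Integration.integrable_bound) (use cmod_sum_sq_le in auto)
  then show ?thesis by (simp add: L2_def)
qed

lemma L2_mult_const: "f \<in> L2 M \<Longrightarrow> (\<lambda>x. c * f x) \<in> L2 M"
  by (auto simp: L2_def norm_mult power_mult_distrib)

lemma L2_diff:
  assumes "f \<in> L2 M" "g \<in> L2 M"
  shows "(\<lambda>x. f x - g x) \<in> L2 M"
  using L2_add[OF assms(1) L2_mult_const[OF assms(2), of "- 1"]] by simp

lemma L2_zero: "(\<lambda>x. 0) \<in> L2 M"
  by (simp add: L2_def)

lemma subspace_L2: "cfun.subspace (L2 M)"
  unfolding cfun.subspace_def
  by (simp add: zero_fun_def plus_fun_def L2_zero L2_add L2_mult_const)

lemma L2_indicator:
  assumes "A \<in> sets M" "emeasure M A < \<infinity>"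
  shows "indicator A \<in> L2 M"
proof -
  have "(\<lambda>x. (cmod (indicator A x))\<^sup>2) = (indicator A :: _ \<Rightarrow> real)"
    by (auto simp: indicator_def)
  then show ?thesis
    using assms by (simp add: L2_def)
qed

lemma L2_inner_integrable:
  assumes "f \<in> L2 M" "g \<in> L2 M"
  shows "integrable M (\<lambda>x. f x * cnj (g x))"
proof -
  note [measurable] = L2_measurable[OF assms(1)] L2_measurable[OF assms(2)]
  have "integrable M (\<lambda>x. (cmod (f x))\<^sup>2 + (cmod (g x))\<^sup>2)"
    using assms by (intro Bochner_Integration.integrable_add L2_sq_integrable)
  then show ?thesis
  proof (rule Bochner_Integration.integrable_bound)
    have [measurable]: "cnj \<in> borel_measurable borel"
      by (intro borel_measurable_continuous_onI continuous_intros)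
    show "(\<lambda>x. f x * cnj (g x)) \<in> borel_measurable M" by measurable
    have "cmod a * cmod b \<le> (cmod a)\<^sup>2 + (cmod b)\<^sup>2" for a b
      using sum_squares_bound[of "cmod a" "cmod b"] mult_nonneg_nonneg[OF norm_ge_zero[of a] norm_ge_zero[of b]]
      by linarith
    then show "AE x in M. norm (f x * cnj (g x)) \<le> norm ((cmod (f x))\<^sup>2 + (cmod (g x))\<^sup>2)"
      by (auto simp: norm_mult)
  qed
qed

section \<open>Inner product and seminorm\<close>

lemma l2_norm_nonneg [simp]: "l2_norm M f \<ge> 0"
  by (simp add: l2_norm_def)

lemma l2_norm_zero [simp]: "l2_norm M (\<lambda>x. 0) = 0"
  by (simp add: l2_norm_def)

lemma l2_norm_sq: "(l2_norm M f)\<^sup>2 = (LINT x|M. (cmod (f x))\<^sup>2)"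
  by (simp add: l2_norm_def)

lemma l2_inner_self: "l2_inner M f f = of_real ((l2_norm M f)\<^sup>2)"
  unfolding l2_inner_def l2_norm_sq complex_norm_square[symmetric]
  by (rule integral_complex_of_real)

lemma l2_norm_mult_const: "l2_norm M (\<lambda>x. c * f x) = cmod c * l2_norm M f"
  by (simp add: l2_norm_def norm_mult power_mult_distrib real_sqrt_mult)

lemma l2_inner_add_left:
  assumes "f \<in> L2 M" "g \<in> L2 M" "h \<in> L2 M"
  shows "l2_inner M (\<lambda>x. f x + g x) h = l2_inner M f h + l2_inner M g h"
  using L2_inner_integrable[OF assms(1,3)] L2_inner_integrable[OF assms(2,3)]
  by (simp add: l2_inner_def distrib_right)

lemma l2_inner_diff_left:
  assumes "f \<in> L2 M" "g \<in> L2 M" "h \<in> L2 M"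
  shows "l2_inner M (\<lambda>x. f x - g x) h = l2_inner M f h - l2_inner M g h"
  using L2_inner_integrable[OF assms(1,3)] L2_inner_integrable[OF assms(2,3)]
  by (simp add: l2_inner_def left_diff_distrib)

lemma l2_inner_mult_left: "l2_inner M (\<lambda>x. c * f x) h = c * l2_inner M f h"
  by (simp add: l2_inner_def mult.assoc)

lemma l2_inner_commute: "l2_inner M g f = cnj (l2_inner M f g)"
proof -
  have "cnj (l2_inner M f g) = (LINT x|M. cnj (f x * cnj (g x)))"
    unfolding l2_inner_def by (rule Bochner_Integration.integral_cnj[symmetric])
  then show ?thesis
    by (simp add: l2_inner_def mult.commute)
qed

lemma l2_inner_zero_left [simp]: "l2_inner M (\<lambda>x. 0) h = 0"
  by (simp add: l2_inner_def)

text \<open>Stated for moduli, so that it yields both the bound on \<open>l2_inner\<close> and the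
  triangle inequality. The inequality for nonnegative integrals is converted using integrability of
  squares and products.\<close>

lemma l2_Cauchy_Schwarz:
  assumes "f \<in> L2 M" "g \<in> L2 M"
  shows "(LINT x|M. cmod (f x) * cmod (g x)) \<le> l2_norm M f * l2_norm M g"
proof -
  note [measurable] = L2_measurable[OF assms(1)] L2_measurable[OF assms(2)]
  have int: "integrable M (\<lambda>x. cmod (f x) * cmod (g x))"
    using integrable_norm[OF L2_inner_integrable[OF assms]] by (simp add: norm_mult)
  have "(\<integral>\<^sup>+x. ennreal (cmod (f x)) * ennreal (cmod (g x)) \<partial>M)\<^sup>2 \<le>
      (\<integral>\<^sup>+x. ennreal (cmod (f x)) ^ 2 \<partial>M) * (\<integral>\<^sup>+x. ennreal (cmod (g x)) ^ 2 \<partial>M)"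
    by (rule Cauchy_Schwarz_nn_integral) measurable
  then have "ennreal ((LINT x|M. cmod (f x) * cmod (g x))\<^sup>2) \<le>
      ennreal ((LINT x|M. (cmod (f x))\<^sup>2) * (LINT x|M. (cmod (g x))\<^sup>2))"
    using L2_sq_integrable[OF assms(1)] L2_sq_integrable[OF assms(2)] int
    by (simp add: nn_integral_eq_integral ennreal_power ennreal_mult flip: ennreal_mult)
  then have "(LINT x|M. cmod (f x) * cmod (g x))\<^sup>2 \<le> (l2_norm M f * l2_norm M g)\<^sup>2"
    by (simp add: power_mult_distrib l2_norm_sq)
  then show ?thesis
    by (rule power2_le_imp_le) simp
qed

lemma l2_inner_bound:
  assumes "f \<in> L2 M" "g \<in> L2 M"
  shows "cmod (l2_inner M f g) \<le> l2_norm M f * l2_norm M g"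
proof -
  have "cmod (l2_inner M f g) \<le> (LINT x|M. cmod (f x * cnj (g x)))"
    unfolding l2_inner_def by (rule integral_norm_bound)
  then show ?thesis
    using l2_Cauchy_Schwarz[OF assms] by (simp add: norm_mult)
qed

lemma l2_norm_triangle:
  assumes "f \<in> L2 M" "g \<in> L2 M"
  shows "l2_norm M (\<lambda>x. f x + g x) \<le> l2_norm M f + l2_norm M g"
proof -
  have int: "integrable M (\<lambda>x. cmod (f x) * cmod (g x))"
    using integrable_norm[OF L2_inner_integrable[OF assms]] by (simp add: norm_mult)
  have "(l2_norm M (\<lambda>x. f x + g x))\<^sup>2 \<le>
      (LINT x|M. (cmod (f x))\<^sup>2 + (cmod (g x))\<^sup>2 + 2 * (cmod (f x) * cmod (g x)))"
    unfolding l2_norm_sq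
  proof (rule integral_mono)
    show "(cmod (f x + g x))\<^sup>2 \<le> (cmod (f x))\<^sup>2 + (cmod (g x))\<^sup>2 + 2 * (cmod (f x) * cmod (g x))" for x
      using power_mono[OF norm_triangle_ineq[of "f x" "g x"], of 2]
      by (simp add: power2_sum)
  qed (use L2_sq_integrable[OF L2_add[OF assms]] L2_sq_integrable[OF assms(1)]
      L2_sq_integrable[OF assms(2)] int in auto)
  also have "\<dots> = (l2_norm M f)\<^sup>2 + (l2_norm M g)\<^sup>2 + 2 * (LINT x|M. cmod (f x) * cmod (g x))"
    using L2_sq_integrable[OF assms(1)] L2_sq_integrable[OF assms(2)] int
    by (simp add: l2_norm_sq)
  also have "\<dots> \<le> (l2_norm M f + l2_norm M g)\<^sup>2"
    using l2_Cauchy_Schwarz[OF assms] by (simp add: power2_sum)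
  finally show ?thesis
    by (rule power2_le_imp_le) simp
qed

lemma l2_norm_triangle_diff:
  assumes "f \<in> L2 M" "g \<in> L2 M" "h \<in> L2 M"
  shows "l2_norm M (\<lambda>x. f x - h x) \<le> l2_norm M (\<lambda>x. f x - g x) + l2_norm M (\<lambda>x. g x - h x)"
  using l2_norm_triangle[OF L2_diff[OF assms(1,2)] L2_diff[OF assms(2,3)]] by simp

lemma l2_norm_eq_0_iff:
  assumes "f \<in> L2 M"
  shows "l2_norm M f = 0 \<longleftrightarrow> (AE x in M. f x = 0)"
proof -
  have "(LINT x|M. (cmod (f x))\<^sup>2) = 0 \<longleftrightarrow> (AE x in M. (cmod (f x))\<^sup>2 = 0)"
    using L2_sq_integrable[OF assms] by (intro integral_nonneg_eq_0_iff_AE) auto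
  then show ?thesis by (simp add: l2_norm_def)
qed

text \<open>In the difference form it says that subtracting an orthogonal vector never decreases the
  norm, which is how the spanning property of the wavelets is obtained.\<close>

lemma l2_norm_Pythagoras:
  assumes "f \<in> L2 M" "g \<in> L2 M" "l2_inner M f g = 0"
  shows "(l2_norm M (\<lambda>x. f x - g x))\<^sup>2 = (l2_norm M f)\<^sup>2 + (l2_norm M g)\<^sup>2"
proof -
  let ?d = "\<lambda>x. f x - g x"
  have d: "?d \<in> L2 M" using assms by (intro L2_diff)
  have "l2_inner M g f = 0" using assms(3) by (simp add: l2_inner_commute[of M g f])
  have "l2_inner M ?d f = l2_inner M f f" "l2_inner M ?d g = - l2_inner M g g"
    using assms \<open>l2_inner M g f = 0\<close> by (simp_all add: l2_inner_diff_left)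
  then have "l2_inner M f ?d = cnj (l2_inner M f f)" "l2_inner M g ?d = - cnj (l2_inner M g g)"
    by (simp_all add: l2_inner_commute[of M _ ?d])
  moreover have "l2_inner M ?d ?d = l2_inner M f ?d - l2_inner M g ?d"
    using assms d by (intro l2_inner_diff_left)
  ultimately have "l2_inner M ?d ?d = of_real ((l2_norm M f)\<^sup>2 + (l2_norm M g)\<^sup>2)"
    by (simp only: l2_inner_self) simp
  then show ?thesis
    unfolding l2_inner_self of_real_eq_iff .
qed

lemma l2_inner_indicator:
  assumes "A \<in> sets M" "B \<in> sets M"
  shows "l2_inner M (indicator A) (indicator B) = of_real (measure M (A \<inter> B))"
proof -
  have "(\<lambda>x. indicator A x * cnj (indicator B x)) = (\<lambda>x. complex_of_real (indicator (A \<inter> B) x))"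
    by (auto simp: indicator_def)
  then show ?thesis
    using assms by (simp add: l2_inner_def)
qed

lemma l2_inner_diff_right:
  assumes "f \<in> L2 M" "g \<in> L2 M" "h \<in> L2 M"
  shows "l2_inner M h (\<lambda>x. f x - g x) = l2_inner M h f - l2_inner M h g"
  using l2_inner_diff_left[OF assms] by (simp add: l2_inner_commute[of M h])

lemma l2_inner_mult_right: "l2_inner M h (\<lambda>x. c * f x) = cnj c * l2_inner M h f"
  using l2_inner_mult_left[of M c f h] by (simp add: l2_inner_commute[of M h])

subsection \<open>Closures\<close>

lemma l2_closure_subset_L2: "l2_closure M S \<subseteq> L2 M"
  by (auto simp: l2_closure_def)

lemma l2_closureE:
  assumes "f \<in> l2_closure M S" "e > 0"
  obtains g where "g \<in> S" "l2_norm M (\<lambda>x. f x - g x) < e"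
  using assms by (auto simp: l2_closure_def)

lemma l2_closure_superset: "S \<subseteq> L2 M \<Longrightarrow> S \<subseteq> l2_closure M S"
  by (force simp: l2_closure_def)

lemma l2_closure_mono: "S \<subseteq> T \<Longrightarrow> l2_closure M S \<subseteq> l2_closure M T"
  unfolding l2_closure_def by blast

lemma l2_closure_closure:
  assumes "S \<subseteq> L2 M"
  shows "l2_closure M (l2_closure M S) = l2_closure M S"
proof (rule equalityI)
  show "l2_closure M S \<subseteq> l2_closure M (l2_closure M S)"
    by (intro l2_closure_superset l2_closure_subset_L2)
  show "l2_closure M (l2_closure M S) \<subseteq> l2_closure M S"
  proof
    fix f assume f: "f \<in> l2_closure M (l2_closure M S)"
    have "\<exists>h\<in>S. l2_norm M (\<lambda>x. f x - h x) < e" if e: "e > 0" for e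
    proof -
      obtain g where g: "g \<in> l2_closure M S" "l2_norm M (\<lambda>x. f x - g x) < e / 2"
        using l2_closureE[OF f half_gt_zero[OF e]] by blast
      then obtain h where h: "h \<in> S" "l2_norm M (\<lambda>x. g x - h x) < e / 2"
        using l2_closureE[OF g(1) half_gt_zero[OF e]] by blast
      have "l2_norm M (\<lambda>x. f x - h x) \<le> l2_norm M (\<lambda>x. f x - g x) + l2_norm M (\<lambda>x. g x - h x)"
        using f g h assms l2_closure_subset_L2 by (intro l2_norm_triangle_diff) blast+
      then show ?thesis using g h by force
    qed
    then show "f \<in> l2_closure M S"
      using f by (simp add: l2_closure_def)
  qed
qed

lemma subspace_l2_closure:
  assumes "cfun.subspace S" "S \<subseteq> L2 M"
  shows "cfun.subspace (l2_closure M S)"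
  unfolding cfun.subspace_def
proof (intro conjI ballI allI)
  show "0 \<in> l2_closure M S"
    using l2_closure_superset[OF assms(2)] cfun.subspace_0[OF assms(1)] by blast
next
  fix f g assume fg: "f \<in> l2_closure M S" "g \<in> l2_closure M S"
  then have L: "f \<in> L2 M" "g \<in> L2 M" using l2_closure_subset_L2 by blast+
  have "\<exists>h\<in>S. l2_norm M (\<lambda>x. f x + g x - h x) < e" if e: "e > 0" for e
  proof -
    obtain f' where f': "f' \<in> S" "l2_norm M (\<lambda>x. f x - f' x) < e / 2"
      using l2_closureE[OF fg(1) half_gt_zero[OF e]] by blast
    obtain g' where g': "g' \<in> S" "l2_norm M (\<lambda>x. g x - g' x) < e / 2"
      using l2_closureE[OF fg(2) half_gt_zero[OF e]] by blast
    have "l2_norm M (\<lambda>x. (f x - f' x) + (g x - g' x)) \<le>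
        l2_norm M (\<lambda>x. f x - f' x) + l2_norm M (\<lambda>x. g x - g' x)"
      using L f' g' assms(2) by (intro l2_norm_triangle L2_diff) auto
    then have "l2_norm M (\<lambda>x. f x + g x - (f' + g') x) < e"
      using f' g' by (simp add: algebra_simps)
    then show ?thesis
      using cfun.subspace_add[OF assms(1) f'(1) g'(1)] by blast
  qed
  then show "f + g \<in> l2_closure M S"
    using L2_add[OF L] by (simp add: l2_closure_def plus_fun_def)
next
  fix c f assume f: "f \<in> l2_closure M S"
  have "\<exists>h\<in>S. l2_norm M (\<lambda>x. c * f x - h x) < e" if e: "e > 0" for e
  proof -
    \<comment> \<open>Adding 1 keeps the tolerance meaningful when c = 0.\<close>
    have "e / (cmod c + 1) > 0" using e by (simp add: add_nonneg_pos)
    then obtain g where g: "g \<in> S" "l2_norm M (\<lambda>x. f x - g x) < e / (cmod c + 1)"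
      using f by (auto simp: l2_closure_def)
    have "l2_norm M (\<lambda>x. c * f x - c * g x) = cmod c * l2_norm M (\<lambda>x. f x - g x)"
      by (simp flip: l2_norm_mult_const right_diff_distrib)
    also have "\<dots> \<le> cmod c * (e / (cmod c + 1))"
      using g(2) by (intro mult_left_mono) auto
    also have "\<dots> < e"
      using e by (simp add: field_simps add_pos_nonneg)
    finally show ?thesis
      using cfun.subspace_scale[OF assms(1) g(1)] by (intro bexI[of _ "\<lambda>x. c * g x"]) auto
  qed
  then show "(\<lambda>x. c * f x) \<in> l2_closure M S"
    using f by (simp add: l2_closure_def L2_mult_const)
qed

lemma span_subset_L2: "S \<subseteq> L2 M \<Longrightarrow> cfun.span S \<subseteq> L2 M"
  by (rule cfun.span_minimal[OF _ subspace_L2])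

lemma closed_subspace_closed_span:
  assumes "S \<subseteq> L2 M"
  shows "closed_subspace M (closed_span M S)"
  unfolding closed_subspace_def closed_span_def
  using l2_closure_closure[OF span_subset_L2[OF assms]]
  by (simp add: l2_closure_subset_L2 subspace_l2_closure cfun.subspace_span span_subset_L2[OF assms])

lemma closed_span_superset: "S \<subseteq> L2 M \<Longrightarrow> S \<subseteq> closed_span M S"
  unfolding closed_span_def
  using l2_closure_superset[OF span_subset_L2] cfun.span_superset by blast

lemma closed_span_minimal:
  assumes "S \<subseteq> V" "closed_subspace M V"
  shows "closed_span M S \<subseteq> V"
proof -
  have "cfun.span S \<subseteq> V"
    using assms by (intro cfun.span_minimal) (simp_all add: closed_subspace_def)
  then show ?thesis
    using assms(2) l2_closure_mono[of "cfun.span S" V M] unfolding closed_span_def closed_subspace_def by blast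
qed

text \<open>Closedness is the continuity of the inner product, from Cauchy-Schwarz. Together with
  \<open>closed_span_minimal\<close> it extends orthogonality from generators to their closed
  span.\<close>

lemma closed_subspace_orthogonal:
  assumes "h \<in> L2 M"
  shows "closed_subspace M {f \<in> L2 M. l2_inner M f h = 0}"
  unfolding closed_subspace_def
proof (intro conjI)
  show "cfun.subspace {f \<in> L2 M. l2_inner M f h = 0}"
    unfolding cfun.subspace_def zero_fun_def plus_fun_def
    using assms by (auto simp: L2_zero L2_add L2_mult_const l2_inner_add_left l2_inner_mult_left)
  show "l2_closure M {f \<in> L2 M. l2_inner M f h = 0} \<subseteq> {f \<in> L2 M. l2_inner M f h = 0}"
  proof
    fix f assume f: "f \<in> l2_closure M {f \<in> L2 M. l2_inner M f h = 0}"
    then have L: "f \<in> L2 M" using l2_closure_subset_L2 by blast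
    have "cmod (l2_inner M f h) \<le> 0"
    proof (rule field_le_epsilon)
      fix e :: real assume "e > 0"
      then have "e / (l2_norm M h + 1) > 0" by (simp add: add_nonneg_pos)
      then obtain g where g: "g \<in> L2 M" "l2_inner M g h = 0"
          "l2_norm M (\<lambda>x. f x - g x) < e / (l2_norm M h + 1)"
        using f by (auto simp: l2_closure_def)
      have "cmod (l2_inner M f h) = cmod (l2_inner M (\<lambda>x. f x - g x) h)"
        using L g assms by (simp add: l2_inner_diff_left)
      also have "\<dots> \<le> l2_norm M (\<lambda>x. f x - g x) * l2_norm M h"
        using L g assms by (intro l2_inner_bound L2_diff)
      also have "\<dots> \<le> e / (l2_norm M h + 1) * l2_norm M h"
        using g by (intro mult_right_mono) auto
      also have "\<dots> \<le> e"
        using \<open>e > 0\<close> by (simp add: field_simps add_pos_nonneg)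
      finally show "cmod (l2_inner M f h) \<le> 0 + e" by simp
    qed
    then show "f \<in> {f \<in> L2 M. l2_inner M f h = 0}" using L by simp
  qed
qed auto

text \<open>Dominated convergence for squares: a pointwise limit under a common integrable bound on
  the squared moduli is also a limit in the seminorm.\<close>

lemma l2_closure_limit:
  assumes s: "\<And>i. s i \<in> l2_closure M S" "S \<subseteq> L2 M"
    and f: "f \<in> borel_measurable M"
    and w: "integrable M w" "\<And>i x. x \<in> space M \<Longrightarrow> (cmod (s i x))\<^sup>2 \<le> w x"
    and lim: "\<And>x. x \<in> space M \<Longrightarrow> (\<lambda>i. s i x) \<longlonglongrightarrow> f x"
  shows "f \<in> l2_closure M S"
proof -
  note [measurable] = f
  have sL: "s i \<in> L2 M" for i using s(1) l2_closure_subset_L2 by blast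
  note [measurable] = L2_measurable[OF sL]
  have fw: "(cmod (f x))\<^sup>2 \<le> w x" if "x \<in> space M" for x
  proof (rule LIMSEQ_le_const2)
    show "(\<lambda>i. (cmod (s i x))\<^sup>2) \<longlonglongrightarrow> (cmod (f x))\<^sup>2"
      using lim[OF that] by (intro tendsto_power tendsto_norm)
  qed (use w(2) that in blast)
  have w0: "0 \<le> w x" if "x \<in> space M" for x
    using fw[OF that] by (rule order_trans[rotated]) simp
  have "integrable M (\<lambda>x. (cmod (f x))\<^sup>2)"
    using w(1) by (rule Bochner_Integration.integrable_bound) (use fw w0 in auto)
  then have fL: "f \<in> L2 M" by (simp add: L2_def)
  have "(\<lambda>i. LINT x|M. (cmod (f x - s i x))\<^sup>2) \<longlonglongrightarrow> (LINT x|M. 0)"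
  \<comment> \<open>Both squared moduli are at most w, and the square of a sum costs a factor 2 on
    each, hence 4.\<close>
  proof (rule integral_dominated_convergence[where w = "\<lambda>x. 4 * w x"])
    show "AE x in M. (\<lambda>i. (cmod (f x - s i x))\<^sup>2) \<longlonglongrightarrow> 0"
    proof (rule AE_I2)
      fix x assume "x \<in> space M"
      then have "(\<lambda>i. (cmod (f x - s i x))\<^sup>2) \<longlonglongrightarrow> (cmod (f x - f x))\<^sup>2"
        by (intro tendsto_intros lim)
      then show "(\<lambda>i. (cmod (f x - s i x))\<^sup>2) \<longlonglongrightarrow> 0" by simp
    qed
    show "AE x in M. norm ((cmod (f x - s i x))\<^sup>2) \<le> 4 * w x" for i
    proof (rule AE_I2)
      fix x assume x: "x \<in> space M"
      show "norm ((cmod (f x - s i x))\<^sup>2) \<le> 4 * w x"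
        using cmod_sum_sq_le[of "f x" "- s i x"] fw[OF x] w(2)[OF x, of i] by simp
    qed
  qed (use w in auto)
  then have "(\<lambda>i. l2_norm M (\<lambda>x. f x - s i x)) \<longlonglongrightarrow> 0"
    unfolding l2_norm_def using tendsto_real_sqrt by fastforce
  then have "\<exists>g \<in> l2_closure M S. l2_norm M (\<lambda>x. f x - g x) < e" if "e > 0" for e
    using order_tendstoD(2)[OF _ that] s(1) by (fastforce simp: eventually_sequentially)
  then have "f \<in> l2_closure M (l2_closure M S)"
    using fL by (simp add: l2_closure_def)
  then show ?thesis
    using l2_closure_closure[OF s(2)] by simp
qed

lemma closed_subspace_l2_closure:
  assumes "closed_subspace M V"
  shows "l2_closure M V = V"
  using assms l2_closure_superset[of V M] by (auto simp: closed_subspace_def)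

lemma sum_fun_apply: "(\<Sum>i\<in>I. f i) x = (\<Sum>i\<in>I. f i x)"
  by (induction I rule: infinite_finite_induct) simp_all

section \<open>The ladder of ball-constant functions\<close>

definition ball_fun :: "int \<Rightarrow> Q2 \<Rightarrow> Q2 \<Rightarrow> complex" where
  "ball_fun n c = indicator (Q2_ball n c)"

lemma ball_fun_split: "ball_fun n c = ball_fun (n + 1) c + ball_fun (n + 1) (c + 2 powi n)"
  using Q2_ball_split[of n c] unfolding ball_fun_def plus_fun_def
  by (auto simp: fun_eq_iff indicator_def)

lemma phi_dilate_translate:
  "(\<lambda>x. indicator Z2 (2 powi (- j) * x - a)) = ball_fun j (2 powi j * a)"
  by (auto simp: ball_fun_def fun_eq_iff indicator_def Z2_eq_ball Q2_ball_translate Q2_ball_dilate)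

text \<open>Translations by \<open>I2\<close> already reach every ball of level j, so the generators
  of V_j can be handled with arbitrary centres.\<close>

lemma phi_dilate_translate_set:
  "{(\<lambda>x. indicator Z2 (2 powi (- j) * x - a)) | a. a \<in> I2} = range (ball_fun j)"
proof -
  have "\<exists>a \<in> I2. ball_fun j c = ball_fun j (2 powi j * a)" for c
    using Q2_ball_representative[of j c] by (auto simp: ball_fun_def)
  then show ?thesis
    unfolding phi_dilate_translate by blast
qed

context Q2_haar
begin

definition Vsp :: "int \<Rightarrow> (Q2 \<Rightarrow> complex) set" where
  "Vsp j = closed_span M (range (ball_fun j))"

lemma ball_fun_L2: "ball_fun n c \<in> L2 M"
  unfolding ball_fun_def by (rule L2_indicator) (simp_all add: Q2_ball_sets[simplified] emeasure_Q2_ball)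

lemma range_ball_fun_L2: "range (ball_fun j) \<subseteq> L2 M"
  using ball_fun_L2 by blast

lemma l2_inner_ball_fun:
  "l2_inner M (ball_fun n c) (ball_fun m d) = of_real (measure M (Q2_ball n c \<inter> Q2_ball m d))"
  unfolding ball_fun_def by (intro l2_inner_indicator Q2_ball_sets)

lemma l2_norm_ball_fun: "l2_norm M (ball_fun n c) = sqrt (2 powi (- n))"
proof -
  have "of_real ((l2_norm M (ball_fun n c))\<^sup>2) = complex_of_real (2 powi (- n))"
    using l2_inner_ball_fun[of n c n c] by (simp only: l2_inner_self Int_absorb measure_Q2_ball)
  then have "(l2_norm M (ball_fun n c))\<^sup>2 = 2 powi (- n)"
    by (simp only: of_real_eq_iff)
  then show ?thesis
    by (metis l2_norm_nonneg real_sqrt_unique)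
qed

lemma closed_subspace_Vsp: "closed_subspace M (Vsp j)"
  unfolding Vsp_def by (intro closed_subspace_closed_span range_ball_fun_L2)

lemma ball_fun_Vsp: "ball_fun j c \<in> Vsp j"
  unfolding Vsp_def using closed_span_superset[OF range_ball_fun_L2] by blast

lemma Vsp_minimal: "range (ball_fun j) \<subseteq> W \<Longrightarrow> closed_subspace M W \<Longrightarrow> Vsp j \<subseteq> W"
  unfolding Vsp_def by (rule closed_span_minimal)

lemma Vsp_L2: "Vsp j \<subseteq> L2 M"
  using closed_subspace_Vsp by (simp add: closed_subspace_def)

lemma subspace_Vsp: "cfun.subspace (Vsp j)"
  using closed_subspace_Vsp by (simp add: closed_subspace_def)

lemma Vsp_Suc: "Vsp j \<subseteq> Vsp (j + 1)"
proof (rule Vsp_minimal[OF _ closed_subspace_Vsp])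
  show "range (ball_fun j) \<subseteq> Vsp (j + 1)"
    using cfun.subspace_add[OF subspace_Vsp ball_fun_Vsp ball_fun_Vsp] ball_fun_split[of j]
    by (metis image_subsetI)
qed

lemma Vsp_mono: "i \<le> j \<Longrightarrow> Vsp i \<subseteq> Vsp j"
  by (induction j rule: int_ge_induct) (use Vsp_Suc in auto)

subsection \<open>Density\<close>

text \<open>Passes from balls to Borel sets inside a ball, to sets of finite measure, to simple
  functions, and to all square-integrable functions. Density uses it for the closure of the union,
  the intersection property for the orthogonal complement of a vector.\<close>

lemma closed_subspace_contains_L2:
  assumes W: "closed_subspace M W" and ball: "\<And>n c. ball_fun n c \<in> W"
  shows "L2 M \<subseteq> W"
proof -
  have sub: "cfun.subspace W" and WL: "W \<subseteq> L2 M"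
    using W by (simp_all add: closed_subspace_def)
  have limit: "f \<in> W" if "\<And>i. s i \<in> W" "f \<in> borel_measurable M" "integrable M w"
      "\<And>i x. (cmod (s i x))\<^sup>2 \<le> w x" "\<And>x. (\<lambda>i. s i x) \<longlonglongrightarrow> f x" for s f w
    using l2_closure_limit[of s M W f w] that closed_subspace_l2_closure[OF W] WL by auto
  \<comment> \<open>Cutting down to a fixed ball keeps complements of finite measure: the complement
    becomes a difference from the indicator of that ball, which also dominates countable disjoint
    unions.\<close>
  have in_ball: "indicator (A \<inter> Q2_ball n c) \<in> W" if "A \<in> sets M" for A n c
  proof -
    let ?K = "Q2_ball n c"
    have A: "A \<in> sigma_sets UNIV (insert {} {Q2_ball n c | n c. True})"
      using that by (simp add: sets_borel_Q2)
    have Pow: "insert {} {Q2_ball n c | n c. True} \<subseteq> Pow UNIV" by simp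
    from Int_stable_Q2_balls Pow A show ?thesis
    proof (induction rule: sigma_sets_induct_disjoint)
      case (basic A)
      then have "A \<inter> ?K \<in> insert {} {Q2_ball n c | n c. True}"
        by (intro Int_stableD[OF Int_stable_Q2_balls]) auto
      then show ?case
        using ball cfun.subspace_0[OF sub] by (auto simp: ball_fun_def zero_fun_def)
    next
      case empty
      then show ?case
        using cfun.subspace_0[OF sub] by (simp add: zero_fun_def)
    next
      case (compl A)
      have "indicator ((UNIV - A) \<inter> ?K) = ball_fun n c - indicator (A \<inter> ?K)"
        by (auto simp: ball_fun_def fun_eq_iff indicator_def)
      then show ?case
        using cfun.subspace_diff[OF sub ball compl.IH] by (simp only:)
    next
      case (union A)
      have A: "A i \<in> sets M" for i
        using union.hyps(2) by (auto simp: sets_borel_Q2)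
      have int: "integrable M (indicator ?K :: _ \<Rightarrow> real)"
        using Q2_ball_sets[of n c] by (simp add: emeasure_Q2_ball)
      show ?case
      proof (rule limit[OF _ _ int])
        show "(\<Sum>j<i. indicator (A j \<inter> ?K)) \<in> W" for i
          using union.IH by (intro cfun.subspace_sum[OF sub])
        have "(\<Union>i. A i) \<inter> ?K \<in> sets M"
          using A Q2_ball_sets[of n c] by blast
        then show "indicator ((\<Union>i. A i) \<inter> ?K) \<in> borel_measurable M"
          by (rule borel_measurable_indicator)
        have sum_eq: "(\<Sum>j<i. indicator (A j \<inter> ?K)) = (indicator ((\<Union>j<i. A j) \<inter> ?K) :: Q2 \<Rightarrow> complex)" for i
        proof -
          have "disjoint_family_on (\<lambda>j. A j \<inter> ?K) {..<i}"
            using union.hyps(1) by (auto simp: disjoint_family_on_def)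
          then have "indicator (\<Union>j<i. A j \<inter> ?K) = (\<lambda>x. \<Sum>j<i. indicator (A j \<inter> ?K) x :: complex)"
            by (intro ext indicator_UN_disjoint) auto
          then show ?thesis
            by (simp add: fun_eq_iff sum_fun_apply)
        qed
        show "(cmod ((\<Sum>j<i. indicator (A j \<inter> ?K)) x))\<^sup>2 \<le> indicator ?K x" for i x
          unfolding sum_eq by (auto simp: indicator_def)
        show "(\<lambda>i. (\<Sum>j<i. indicator (A j \<inter> ?K)) x) \<longlonglongrightarrow> (indicator ((\<Union>i. A i) \<inter> ?K) x :: complex)" for x
          unfolding sum_eq using LIMSEQ_indicator_UN[of "\<lambda>j. A j \<inter> ?K" x] by simp
      qed
    qed
  qed
  have finite_measure: "indicator A \<in> W" if A: "A \<in> sets M" "emeasure M A < \<infinity>" for A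
  proof (rule limit[of "\<lambda>i. indicator (A \<inter> Q2_ball (- int i) 0)"])
    show "indicator (A \<inter> Q2_ball (- int i) 0) \<in> W" for i
      using in_ball[OF A(1)] .
    show "integrable M (indicator A :: _ \<Rightarrow> real)" using A by simp
    show "(\<lambda>i. indicator (A \<inter> Q2_ball (- int i) 0) x) \<longlonglongrightarrow> (indicator A x :: complex)" for x
    proof (rule tendsto_eventually)
      obtain n where n: "x \<in> Q2_ball (- int n) 0"
        using UN_Q2_ball by blast
      have "x \<in> Q2_ball (- int i) 0" if "i \<ge> n" for i
        using Q2_ball_mono[of "- int i" "- int n" 0] n that by auto
      then show "\<forall>\<^sub>F i in sequentially. indicator (A \<inter> Q2_ball (- int i) 0) x = (indicator A x :: complex)"
        unfolding eventually_sequentially by (intro exI[of _ n]) (auto simp: indicator_def)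
    qed
  qed (use A in \<open>auto simp: indicator_def\<close>)
  have simple: "F \<in> W" if F: "simple_function M F" and FL: "F \<in> L2 M" for F
  proof -
    have "(\<lambda>x. y * indicator (F -` {y}) x) \<in> W" for y
    \<comment> \<open>The level set of 0 may have infinite measure, but its term vanishes.\<close>
    proof (cases "y = 0")
      case True
      then show ?thesis
        using cfun.subspace_0[OF sub] by (simp add: zero_fun_def)
    next
      case False
      define A where "A = F -` {y}"
      have A: "A \<in> sets M"
        using simple_functionD(2)[OF F, of "{y}"] by (simp add: A_def)
      \<comment> \<open>Chebyshev's argument: the function is dominated by the squared modulus of F,
        so a nonzero value is attained on a set of finite measure.\<close>
      have "integrable M (\<lambda>x. (cmod y)\<^sup>2 * indicator A x :: real)"
        by (rule Bochner_Integration.integrable_bound[OF L2_sq_integrable[OF FL]])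
          (use A in \<open>auto simp: A_def[THEN eqset_imp_iff] split: split_indicator\<close>)
      then have "emeasure M A < \<infinity>"
        using False A by (simp add: integrable_indicator_iff)
      then show ?thesis
        using finite_measure[OF A] cfun.subspace_scale[OF sub, of "indicator A" y] by (simp only: A_def)
    qed
    then have "(\<Sum>y\<in>range F. (\<lambda>x. y * indicator (F -` {y}) x)) \<in> W"
      by (intro cfun.subspace_sum[OF sub])
    moreover have "(\<Sum>y\<in>range F. (\<lambda>x. y * indicator (F -` {y}) x)) = F"
    proof
      fix x
      have "finite (range F)"
        using simple_functionD(1)[OF F] by simp
      then have "(\<Sum>y\<in>range F. y * indicator (F -` {y}) x) = (\<Sum>y\<in>range F. if y = F x then F x else 0)"
        by (intro sum.cong) (auto simp: indicator_def)
      also have "\<dots> = F x"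
        using \<open>finite (range F)\<close> by (simp add: sum.delta)
      finally show "(\<Sum>y\<in>range F. (\<lambda>x. y * indicator (F -` {y}) x)) x = F x"
        by (simp add: sum_fun_apply)
    qed
    ultimately show ?thesis by simp
  qed
  show ?thesis
  proof
    fix f assume f: "f \<in> L2 M"
    obtain F where F: "\<And>i. simple_function M (F i)" "\<And>x. (\<lambda>i. F i x) \<longlonglongrightarrow> f x"
        "\<And>i x. cmod (F i x) \<le> 2 * cmod (f x)"
      using borel_measurable_implies_sequence_metric[OF L2_measurable[OF f], of 0] by auto
    \<comment> \<open>The approximating simple functions are only bounded by twice the modulus of f;
      squaring gives the 4.\<close>
    have sq: "(cmod (F i x))\<^sup>2 \<le> 4 * (cmod (f x))\<^sup>2" for i x
      using power_mono[OF F(3)[of i x], of 2] by (simp add: power_mult_distrib)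
    have int: "integrable M (\<lambda>x. 4 * (cmod (f x))\<^sup>2)"
      using L2_sq_integrable[OF f] by simp
    show "f \<in> W"
    proof (rule limit[OF _ L2_measurable[OF f] int sq F(2)])
      fix i
      have meas: "F i \<in> borel_measurable M"
        using F(1) by (rule borel_measurable_simple_function)
      have "integrable M (\<lambda>x. (cmod (F i x))\<^sup>2)"
        by (rule Bochner_Integration.integrable_bound[OF int]) (use meas sq in auto)
      then show "F i \<in> W"
        using simple[OF F(1)] meas by (simp add: L2_def)
    qed
  qed
qed

text \<open>Nesting makes the union a subspace, so its closure is a closed subspace containing the
  balls of every level.\<close>

lemma Vsp_dense: "l2_closure M (\<Union>j. Vsp j) = L2 M"
proof (rule equalityI[OF l2_closure_subset_L2])
  have UL: "(\<Union>j. Vsp j) \<subseteq> L2 M" using Vsp_L2 by blast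
  have "cfun.subspace (\<Union>j. Vsp j)"
    unfolding cfun.subspace_def
  proof (intro conjI ballI allI)
    show "0 \<in> (\<Union>j. Vsp j)"
      using cfun.subspace_0[OF subspace_Vsp] by blast
    show "(\<lambda>x. c * f x) \<in> (\<Union>j. Vsp j)" if "f \<in> (\<Union>j. Vsp j)" for c f
      using that cfun.subspace_scale[OF subspace_Vsp] by blast
    fix f g assume "f \<in> (\<Union>j. Vsp j)" "g \<in> (\<Union>j. Vsp j)"
    then obtain i j where "f \<in> Vsp i" "g \<in> Vsp j" by blast
    then have "f \<in> Vsp (max i j)" "g \<in> Vsp (max i j)"
      using Vsp_mono[of i "max i j"] Vsp_mono[of j "max i j"] by auto
    then show "f + g \<in> (\<Union>j. Vsp j)"
      using cfun.subspace_add[OF subspace_Vsp] by blast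
  qed
  then have "closed_subspace M (l2_closure M (\<Union>j. Vsp j))"
    using subspace_l2_closure[OF _ UL] l2_closure_closure[OF UL] l2_closure_subset_L2
    by (auto simp: closed_subspace_def)
  then show "L2 M \<subseteq> l2_closure M (\<Union>j. Vsp j)"
    using l2_closure_superset[OF UL] ball_fun_Vsp by (intro closed_subspace_contains_L2) blast+
qed

subsection \<open>Intersection\<close>

text \<open>Functions in \<open>Vsp j\<close> are constant on the large ball \<open>Q2_ball j c\<close>, so their integral over
  a small concentric ball is determined by the integral over the large one.\<close>

lemma Vsp_inner_ball_fun:
  assumes "f \<in> Vsp j" "j \<le> n"
  shows "l2_inner M f (ball_fun n c) = 2 powi (j - n) * l2_inner M f (ball_fun j c)"
proof -
  define t :: complex where "t = 2 powi (j - n)"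
  have cnj_t: "cnj t = t"
    by (simp add: t_def complex_cnj_power_int)
  \<comment> \<open>The factor t is the ratio of the two measures, so h has integral 0 over the
    large ball and vanishes outside it. It is therefore orthogonal to all generators of
    \<open>Vsp j\<close>, and the claim is orthogonality of f to h.\<close>
  define h where "h = (\<lambda>x. ball_fun n c x - t * ball_fun j c x)"
  have hL: "h \<in> L2 M"
    unfolding h_def by (intro L2_diff L2_mult_const ball_fun_L2)
  have inner_h: "l2_inner M f h = l2_inner M f (ball_fun n c) - t * l2_inner M f (ball_fun j c)"
    if "f \<in> L2 M" for f
    unfolding h_def
    by (simp add: l2_inner_diff_right l2_inner_mult_right L2_mult_const ball_fun_L2 that cnj_t)
  have "l2_inner M (ball_fun j d) h = 0" for d
  proof (cases "Q2_ball j d = Q2_ball j c")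
    case True
    have "Q2_ball j d \<inter> Q2_ball n c = Q2_ball n c"
      using True Q2_ball_mono[OF assms(2), of c] by auto
    moreover have "(2 :: complex) powi (j - n) * 2 powi (- j) = 2 powi (- n)"
      by (simp flip: power_int_add)
    ultimately show ?thesis
      using True by (simp add: inner_h ball_fun_L2 l2_inner_ball_fun measure_Q2_ball t_def)
  next
    case False
    then have "Q2_ball j d \<inter> Q2_ball j c = {}" by (rule Q2_ball_disjoint)
    moreover from this have "Q2_ball j d \<inter> Q2_ball n c = {}"
      using Q2_ball_mono[OF assms(2), of c] by auto
    ultimately show ?thesis
      by (simp add: inner_h ball_fun_L2 l2_inner_ball_fun)
  qed
  then have "Vsp j \<subseteq> {f \<in> L2 M. l2_inner M f h = 0}"
    using ball_fun_L2 by (intro Vsp_minimal closed_subspace_orthogonal hL) auto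
  then show ?thesis
    using assms(1) inner_h[of f] by (auto simp: t_def)
qed

lemma Inter_Vsp: "(\<Inter>j. Vsp j) = {f \<in> L2 M. AE x in M. f x = 0}"
proof (intro equalityI subsetI)
  fix f assume "f \<in> (\<Inter>j. Vsp j)"
  then have f: "f \<in> Vsp j" for j by blast
  then have fL: "f \<in> L2 M" using Vsp_L2 by blast
  have "l2_inner M f (ball_fun n c) = 0" for n c
  proof -
    \<comment> \<open>Comparison with the ball of level -k: constancy contributes
      \<open>2 powi (- k - n)\<close>, and Cauchy-Schwarz against that ball contributes its norm
      \<open>sqrt 2 ^ k\<close>. Letting k grow leaves 0.\<close>
    have bound: "cmod (l2_inner M f (ball_fun n c)) \<le> l2_norm M f * 2 powi (- n) / (sqrt 2) ^ k"
      if k: "- int k \<le> n" for k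
    proof -
      have "cmod (l2_inner M f (ball_fun n c)) = 2 powi (- int k - n) * cmod (l2_inner M f (ball_fun (- int k) c))"
        using Vsp_inner_ball_fun[OF f k, of c] by (simp add: norm_mult norm_power_int)
      also have "\<dots> \<le> 2 powi (- int k - n) * (l2_norm M f * sqrt (2 powi (int k)))"
        using l2_inner_bound[OF fL ball_fun_L2[of "- int k" c]]
        by (intro mult_left_mono) (simp_all add: l2_norm_ball_fun)
      also have "2 powi (- int k - n) * (l2_norm M f * sqrt (2 powi (int k))) =
          l2_norm M f * 2 powi (- n) / (sqrt 2) ^ k"
      proof -
        have "(2 :: real) powi (- int k - n) = 2 powi (- n) / (sqrt 2 ^ k * sqrt 2 ^ k)"
          using power_int_diff[of "2 :: real" "- n" "int k"]
          by (simp add: minus_diff_commute[of "int k" n] flip: power_mult_distrib)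
        then show ?thesis
          by (simp add: real_sqrt_power)
      qed
      finally show ?thesis .
    qed
    have "(\<lambda>k. l2_norm M f * 2 powi (- n) * (1 / sqrt 2) ^ k) \<longlonglongrightarrow> l2_norm M f * 2 powi (- n) * 0"
      by (intro tendsto_mult tendsto_const LIMSEQ_power_zero) simp
    then have "cmod (l2_inner M f (ball_fun n c)) \<le> l2_norm M f * 2 powi (- n) * 0"
    proof (rule LIMSEQ_le_const)
      show "\<exists>N. \<forall>k\<ge>N. cmod (l2_inner M f (ball_fun n c)) \<le> l2_norm M f * 2 powi (- n) * (1 / sqrt 2) ^ k"
        using bound by (intro exI[of _ "nat (- n)"]) (auto simp: power_one_over)
    qed
    then show ?thesis by simp
  qed
  then have "l2_inner M (ball_fun n c) f = 0" for n c
    by (simp add: l2_inner_commute[of M _ f])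
  \<comment> \<open>The orthogonal complement of f is closed and contains all balls, so it contains
    f itself.\<close>
  then have "L2 M \<subseteq> {g \<in> L2 M. l2_inner M g f = 0}"
    using ball_fun_L2 by (intro closed_subspace_contains_L2 closed_subspace_orthogonal fL) auto
  then have "l2_inner M f f = 0" using fL by blast
  then have "l2_norm M f = 0" by (simp add: l2_inner_self)
  then show "f \<in> {f \<in> L2 M. AE x in M. f x = 0}"
    using fL l2_norm_eq_0_iff[OF fL] by simp
next
  fix f assume f: "f \<in> {f \<in> L2 M. AE x in M. f x = 0}"
  \<comment> \<open>A null function is at seminorm distance 0 from the zero function, so every
    closed subspace contains it.\<close>
  then have "l2_norm M (\<lambda>x. f x - 0) = 0"
    using l2_norm_eq_0_iff[of f M] by simp
  then have "f \<in> l2_closure M (Vsp j)" for j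
    using f cfun.subspace_0[OF subspace_Vsp, of j] by (auto simp: l2_closure_def intro!: bexI[of _ 0])
  then show "f \<in> (\<Inter>j. Vsp j)"
    using closed_subspace_l2_closure[OF closed_subspace_Vsp] by simp
qed

subsection \<open>Dilation\<close>

lemma measurable_dilate: "(\<lambda>x. 2 powi k * x) \<in> measurable M M"
  using measurable_Q2_affine[of "2 powi k" 0] by simp

lemma dilate_integral:
  fixes g :: "Q2 \<Rightarrow> real"
  assumes [measurable]: "g \<in> borel_measurable M"
  shows "(LINT x|M. g (2 powi k * x)) = 2 powi k * (LINT x|M. g x)"
    and "integrable M (\<lambda>x. g (2 powi k * x)) \<longleftrightarrow> integrable M g"
proof -
  note [measurable] = measurable_dilate
  have "(LINT x|M. g (2 powi k * x)) = (LINT x|distr M M (\<lambda>x. 2 powi k * x). g x)"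
    by (rule integral_distr[symmetric]) measurable
  also have "\<dots> = (LINT x|M. 2 powi k *\<^sub>R g x)"
    unfolding distr_dilate by (rule integral_density) auto
  finally show "(LINT x|M. g (2 powi k * x)) = 2 powi k * (LINT x|M. g x)" by simp
  have "integrable M (\<lambda>x. g (2 powi k * x)) \<longleftrightarrow> integrable (distr M M (\<lambda>x. 2 powi k * x)) g"
    by (rule integrable_distr_eq[symmetric]) measurable
  also have "\<dots> \<longleftrightarrow> integrable M (\<lambda>x. 2 powi k *\<^sub>R g x)"
    unfolding distr_dilate by (rule integrable_density) auto
  finally show "integrable M (\<lambda>x. g (2 powi k * x)) \<longleftrightarrow> integrable M g" by simp
qed

lemma L2_dilate:
  assumes "f \<in> L2 M"
  shows "(\<lambda>x. f (2 powi k * x)) \<in> L2 M"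
    and "l2_norm M (\<lambda>x. f (2 powi k * x)) = sqrt (2 powi k) * l2_norm M f"
proof -
  note [measurable] = L2_measurable[OF assms] measurable_dilate
  have "(\<lambda>x. f (2 powi k * x)) \<in> borel_measurable M" by measurable
  then show "(\<lambda>x. f (2 powi k * x)) \<in> L2 M"
    using dilate_integral(2)[of "\<lambda>x. (cmod (f x))\<^sup>2" k] L2_sq_integrable[OF assms]
    by (simp add: L2_def)
  show "l2_norm M (\<lambda>x. f (2 powi k * x)) = sqrt (2 powi k) * l2_norm M f"
    using dilate_integral(1)[of "\<lambda>x. (cmod (f x))\<^sup>2" k]
    by (simp add: l2_norm_def real_sqrt_mult)
qed

text \<open>A dilation maps balls of level j to balls of level j - k, hence spans to spans, and it
  multiplies the norm by a constant, hence respects closures.\<close>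

lemma Vsp_dilate:
  assumes "f \<in> Vsp j"
  shows "(\<lambda>x. f (2 powi k * x)) \<in> Vsp (j - k)"
proof -
  let ?S = "\<lambda>j. cfun.span (range (ball_fun j))"
  have "?S j \<subseteq> {f. (\<lambda>x. f (2 powi k * x)) \<in> ?S (j - k)}"
  proof (rule cfun.span_minimal)
    have "(\<lambda>x. ball_fun j c (2 powi k * x)) = ball_fun (j - k) (2 powi (- k) * c)" for c
      by (simp add: ball_fun_def fun_eq_iff indicator_def Q2_ball_dilate)
    then show "range (ball_fun j) \<subseteq> {f. (\<lambda>x. f (2 powi k * x)) \<in> ?S (j - k)}"
      by (auto intro: cfun.span_base)
    show "cfun.subspace {f. (\<lambda>x. f (2 powi k * x)) \<in> ?S (j - k)}"
      unfolding cfun.subspace_def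
      using cfun.span_zero[of "range (ball_fun (j - k))"] cfun.span_add[of _ "range (ball_fun (j - k))"]
        cfun.span_scale[of _ "range (ball_fun (j - k))"]
      by (auto simp: zero_fun_def plus_fun_def)
  qed
  then have span: "(\<lambda>x. g (2 powi k * x)) \<in> ?S (j - k)" if "g \<in> ?S j" for g
    using that by blast
  have fL: "f \<in> L2 M" using assms Vsp_L2 by blast
  have f: "f \<in> l2_closure M (?S j)" using assms by (simp add: Vsp_def closed_span_def)
  have "\<exists>h \<in> ?S (j - k). l2_norm M (\<lambda>x. f (2 powi k * x) - h x) < e" if e: "e > 0" for e
  proof -
    have "e / sqrt (2 powi k) > 0" using e by simp
    then obtain g where g: "g \<in> ?S j" "l2_norm M (\<lambda>x. f x - g x) < e / sqrt (2 powi k)"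
      using l2_closureE[OF f] by blast
    have "g \<in> L2 M" using g(1) span_subset_L2[OF range_ball_fun_L2] by blast
    then have "l2_norm M (\<lambda>x. f (2 powi k * x) - g (2 powi k * x)) = sqrt (2 powi k) * l2_norm M (\<lambda>x. f x - g x)"
      using L2_dilate(2)[OF L2_diff[OF fL]] by simp
    also have "\<dots> < e"
      using g(2) by (simp add: pos_less_divide_eq mult.commute)
    finally show ?thesis
      using span[OF g(1)] by (intro bexI[of _ "\<lambda>x. g (2 powi k * x)"])
  qed
  then show ?thesis
    unfolding Vsp_def closed_span_def using L2_dilate(1)[OF fL] by (simp add: l2_closure_def)
qed

text \<open>The converse dilates back by 2.\<close>

lemma Vsp_dilate_iff: "f \<in> Vsp j \<longleftrightarrow> (\<lambda>x. f (inverse 2 * x)) \<in> Vsp (j + 1)"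
  using Vsp_dilate[of f j "- 1"] Vsp_dilate[of "\<lambda>x. f (inverse 2 * x)" "j + 1" 1]
  by (auto simp: power_int_minus simp flip: mult.assoc)

end

section \<open>The wavelet function\<close>

text \<open>The 2-adic Haar wavelet translated by a: 1 on the half of the unit ball around a that
  contains a, -1 on the other half, 0 elsewhere.\<close>

definition wavelet_fun :: "Q2 \<Rightarrow> Q2 \<Rightarrow> complex" where
  "wavelet_fun a x = ball_fun 1 a x - ball_fun 1 (a + 1) x"

lemma wavelet_fun_0: "indicator Z2 (x / 2) - indicator Z2 (x / 2 - 1 / 2) = wavelet_fun 0 x"
proof -
  have half: "y / 2 \<in> Z2 \<longleftrightarrow> y \<in> Q2_ball 1 0" for y :: Q2
    using Q2_ball_dilate[of "- 1" y 0 0] by (simp add: Z2_eq_ball power_int_minus field_simps)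
  have "x / 2 - 1 / 2 \<in> Z2 \<longleftrightarrow> x \<in> Q2_ball 1 1"
    using half[of "x - 1"] by (simp add: diff_divide_distrib Q2_ball_translate)
  then show ?thesis
    by (simp add: wavelet_fun_def ball_fun_def indicator_def half)
qed

lemma ball_fun_split_0: "ball_fun 0 a x = ball_fun 1 a x + ball_fun 1 (a + 1) x"
  using fun_cong[OF ball_fun_split[of 0 a], of x] by simp

text \<open>Sum and difference of the two half-ball indicators recover each of them; the sign
  depends on which half of the unit ball contains c.\<close>

lemma ball_fun_1_decomposition:
  "\<exists>a \<in> I2. ball_fun 1 c = (\<lambda>x. 1 / 2 * (ball_fun 0 a x + wavelet_fun a x)) \<or>
    ball_fun 1 c = (\<lambda>x. 1 / 2 * (ball_fun 0 a x - wavelet_fun a x))"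
proof -
  obtain a where a: "a \<in> I2" "Q2_ball 0 c = Q2_ball 0 a"
    using Q2_ball_representative[of 0 c] by auto
  have "c \<in> Q2_ball 0 a"
    using center_in_Q2_ball[of c 0] a(2) by simp
  then have "c \<in> Q2_ball 1 a \<or> c \<in> Q2_ball 1 (a + 1)"
    using Q2_ball_split(1)[of 0 a] by simp
  then consider "ball_fun 1 c = ball_fun 1 a" | "ball_fun 1 c = ball_fun 1 (a + 1)"
    using Q2_ball_recenter[of c 1 a] Q2_ball_recenter[of c 1 "a + 1"] unfolding ball_fun_def by metis
  then show ?thesis
    using a(1) by cases (auto simp: ball_fun_split_0 wavelet_fun_def fun_eq_iff)
qed

lemma I2_unit_balls_disjoint:
  assumes "a \<in> I2" "b \<in> I2" "a \<noteq> b"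
  shows "Q2_ball 0 a \<inter> Q2_ball 0 b = {}"
proof (rule Q2_ball_disjoint)
  have "a \<notin> Q2_ball 0 b"
    using I2_unique[OF assms(1,2)] assms(3) by (auto simp: Q2_ball_def)
  then show "Q2_ball 0 a \<noteq> Q2_ball 0 b"
    using center_in_Q2_ball[of a 0] by blast
qed

lemma wavelet_fun_eq_0: "x \<notin> Q2_ball 0 a \<Longrightarrow> wavelet_fun a x = 0"
  using Q2_ball_split(1)[of 0 a] by (simp add: wavelet_fun_def ball_fun_def)

lemma wavelet_fun_sq: "x \<in> Q2_ball 0 a \<Longrightarrow> wavelet_fun a x * cnj (wavelet_fun a x) = 1"
  using Q2_ball_split[of 0 a] by (auto simp: wavelet_fun_def ball_fun_def indicator_def)

text \<open>Wavelets are unimodular on their unit balls, and the balls of distinct representatives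
  are disjoint, so orthonormality reduces to unit balls having measure 1.\<close>

lemma wavelet_fun_mult:
  assumes "a \<in> I2" "b \<in> I2"
  shows "wavelet_fun a x * cnj (wavelet_fun b x) = (if a = b then indicator (Q2_ball 0 a) x else 0)"
proof (cases "a = b")
  case True
  then show ?thesis
    by (cases "x \<in> Q2_ball 0 a") (simp_all add: wavelet_fun_eq_0 wavelet_fun_sq)
next
  case False
  then have "x \<notin> Q2_ball 0 a \<or> x \<notin> Q2_ball 0 b"
    using I2_unit_balls_disjoint[OF assms] by blast
  then show ?thesis
    using False by (auto simp: wavelet_fun_eq_0)
qed

lemma wavelet_fun_translate: "wavelet_fun 0 (x - a) = wavelet_fun a x"
  by (simp add: wavelet_fun_def ball_fun_def indicator_def Q2_ball_translate add.commute)

lemma ball_fun_0_mult: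
  assumes "a \<in> I2" "b \<in> I2"
  shows "ball_fun 0 a x * cnj (ball_fun 0 b x) = (if a = b then indicator (Q2_ball 0 a) x else 0)"
  using I2_unit_balls_disjoint[OF assms] by (auto simp: ball_fun_def indicator_def)

section \<open>Orthonormality and span of the wavelets\<close>

context Q2_haar
begin

lemma wavelet_fun_L2: "wavelet_fun a \<in> L2 M"
  using L2_diff[OF ball_fun_L2 ball_fun_L2, of 1 a 1 "a + 1"] by (simp add: wavelet_fun_def[abs_def])

lemma wavelet_fun_Vsp: "wavelet_fun a \<in> Vsp 1"
  using cfun.subspace_diff[OF subspace_Vsp ball_fun_Vsp ball_fun_Vsp, of 1 a "a + 1"]
  by (simp add: wavelet_fun_def[abs_def] fun_diff_def)

lemma integral_indicator_unit_ball: "(LINT x|M. indicator (Q2_ball 0 a) x) = (1 :: complex)"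
proof -
  have "(LINT x|M. indicator (Q2_ball 0 a) x) = (LINT x|M. complex_of_real (indicator (Q2_ball 0 a) x))"
    by (intro Bochner_Integration.integral_cong) (auto simp: indicator_def)
  also have "\<dots> = complex_of_real (LINT x|M. indicator (Q2_ball 0 a) x)"
    by (rule integral_complex_of_real)
  also have "\<dots> = 1"
    by (simp add: measure_Q2_ball)
  finally show ?thesis .
qed

lemma ball_fun_orthonormal:
  assumes "a \<in> I2" "b \<in> I2"
  shows "l2_inner M (ball_fun 0 a) (ball_fun 0 b) = (if a = b then 1 else 0)"
  using assms by (simp add: l2_inner_def ball_fun_0_mult integral_indicator_unit_ball)

lemma wavelet_fun_orthonormal:
  assumes "a \<in> I2" "b \<in> I2"
  shows "l2_inner M (wavelet_fun a) (wavelet_fun b) = (if a = b then 1 else 0)"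
  using assms by (simp add: l2_inner_def wavelet_fun_mult integral_indicator_unit_ball)

text \<open>The unit ball around b contains both halves of the one around a, which have equal
  measure, or meets neither.\<close>

lemma wavelet_fun_orthogonal_ball_fun: "l2_inner M (wavelet_fun a) (ball_fun 0 b) = 0"
proof -
  have "measure M (Q2_ball 1 a \<inter> Q2_ball 0 b) = measure M (Q2_ball 1 (a + 1) \<inter> Q2_ball 0 b)"
  proof (cases "Q2_ball 0 a = Q2_ball 0 b")
    case True
    then have "Q2_ball 1 a \<subseteq> Q2_ball 0 b" "Q2_ball 1 (a + 1) \<subseteq> Q2_ball 0 b"
      using Q2_ball_split(1)[of 0 a] by auto
    then show ?thesis
      by (simp add: Int_absorb2 measure_Q2_ball)
  next
    case False
    then have "Q2_ball 1 a \<inter> Q2_ball 0 b = {}" "Q2_ball 1 (a + 1) \<inter> Q2_ball 0 b = {}"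
      using Q2_ball_split(1)[of 0 a] Q2_ball_disjoint[OF False] by auto
    then show ?thesis by simp
  qed
  then show ?thesis
    using l2_inner_diff_left[OF ball_fun_L2 ball_fun_L2 ball_fun_L2, of 1 a 1 "a + 1" 0 b]
    by (simp add: wavelet_fun_def[abs_def] l2_inner_ball_fun)
qed

lemma wavelet_space_Vsp:
  "wavelet_space M Vsp = {f \<in> Vsp 1. \<forall>b. l2_inner M f (ball_fun 0 b) = 0}"
proof -
  have "l2_inner M f g = 0" if f: "f \<in> Vsp 1" "\<forall>b. l2_inner M f (ball_fun 0 b) = 0" and g: "g \<in> Vsp 0" for f g
  proof -
    have fL: "f \<in> L2 M" using f(1) Vsp_L2 by blast
    have "l2_inner M (ball_fun 0 b) f = 0" for b
      using f(2) by (simp add: l2_inner_commute[of M _ f])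
    then have "Vsp 0 \<subseteq> {g \<in> L2 M. l2_inner M g f = 0}"
      using ball_fun_L2 by (intro Vsp_minimal closed_subspace_orthogonal fL) auto
    then show ?thesis
      using g by (auto simp: l2_inner_commute[of M f g])
  qed
  then show ?thesis
    using ball_fun_Vsp by (auto simp: wavelet_space_def)
qed

text \<open>For the harder inclusion, an approximant from the span of half-ball indicators is split
  into a V_0 part and a wavelet part, and the V_0 part is discarded.\<close>

lemma closed_span_wavelet_fun: "closed_span M (wavelet_fun ` I2) = wavelet_space M Vsp"
proof (rule equalityI)
  have WL: "wavelet_fun ` I2 \<subseteq> L2 M" using wavelet_fun_L2 by blast
  have "closed_span M (wavelet_fun ` I2) \<subseteq> Vsp 1"
    using wavelet_fun_Vsp by (intro closed_span_minimal closed_subspace_Vsp) blast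
  moreover have "closed_span M (wavelet_fun ` I2) \<subseteq> {f \<in> L2 M. l2_inner M f (ball_fun 0 b) = 0}" for b
    using wavelet_fun_L2 wavelet_fun_orthogonal_ball_fun
    by (intro closed_span_minimal closed_subspace_orthogonal ball_fun_L2) blast
  ultimately show sub: "closed_span M (wavelet_fun ` I2) \<subseteq> wavelet_space M Vsp"
    unfolding wavelet_space_Vsp by blast
  show "wavelet_space M Vsp \<subseteq> closed_span M (wavelet_fun ` I2)"
  proof
    fix f assume f: "f \<in> wavelet_space M Vsp"
    then have f1: "f \<in> l2_closure M (cfun.span (range (ball_fun 1)))"
      by (simp add: wavelet_space_def Vsp_def closed_span_def)
    then have fL: "f \<in> L2 M" using l2_closure_subset_L2 by blast
    let ?U = "range (ball_fun 0) \<union> wavelet_fun ` I2"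
    have "range (ball_fun 1) \<subseteq> cfun.span ?U"
    proof
      fix h assume "h \<in> range (ball_fun 1)"
      then obtain c where h: "h = ball_fun 1 c" by blast
      obtain a where a: "a \<in> I2" "ball_fun 1 c = (\<lambda>x. 1 / 2 * (ball_fun 0 a + wavelet_fun a) x) \<or>
          ball_fun 1 c = (\<lambda>x. 1 / 2 * (ball_fun 0 a - wavelet_fun a) x)"
        using ball_fun_1_decomposition[of c] by auto
      have "ball_fun 0 a \<in> cfun.span ?U" "wavelet_fun a \<in> cfun.span ?U"
        using a(1) by (auto intro: cfun.span_base)
      then have "ball_fun 0 a + wavelet_fun a \<in> cfun.span ?U" "ball_fun 0 a - wavelet_fun a \<in> cfun.span ?U"
        by (rule cfun.span_add, rule cfun.span_diff)
      from this[THEN cfun.span_scale, of "1 / 2"] show "h \<in> cfun.span ?U"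
        using a(2) unfolding h by metis
    qed
    then have span1: "cfun.span (range (ball_fun 1)) \<subseteq> cfun.span ?U"
      by (rule cfun.span_minimal) (rule cfun.subspace_span)
    have "\<exists>h \<in> cfun.span (wavelet_fun ` I2). l2_norm M (\<lambda>x. f x - h x) < e" if e: "e > 0" for e
    proof -
      obtain g where g: "g \<in> cfun.span (range (ball_fun 1))" "l2_norm M (\<lambda>x. f x - g x) < e"
        using l2_closureE[OF f1 e] by blast
      obtain g0 g1 where g01: "g0 \<in> cfun.span (range (ball_fun 0))" "g1 \<in> cfun.span (wavelet_fun ` I2)"
          "g = g0 + g1"
        using g(1) span1 unfolding cfun.span_Un by blast
      have g0: "g0 \<in> Vsp 0" "g0 \<in> L2 M"
        using g01(1) l2_closure_superset[OF span_subset_L2[OF range_ball_fun_L2]]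
          span_subset_L2[OF range_ball_fun_L2]
        by (auto simp: Vsp_def closed_span_def)
      have g1: "g1 \<in> wavelet_space M Vsp" "g1 \<in> L2 M"
        using g01(2) l2_closure_superset[OF span_subset_L2[OF WL]] span_subset_L2[OF WL] sub
        by (auto simp: closed_span_def)
      have orth: "l2_inner M (\<lambda>x. f x - g1 x) g0 = 0"
        using f g1 g0 fL by (simp add: l2_inner_diff_left wavelet_space_def)
      \<comment> \<open>Both f and g1 lie in the wavelet space, so f - g1 is orthogonal to g0, and
        Pythagoras shows that g0 only adds to the error.\<close>
      have "(l2_norm M (\<lambda>x. f x - g1 x))\<^sup>2 \<le> (l2_norm M (\<lambda>x. (f x - g1 x) - g0 x))\<^sup>2"
        unfolding l2_norm_Pythagoras[OF L2_diff[OF fL g1(2)] g0(2) orth] by simp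
      then have "l2_norm M (\<lambda>x. f x - g1 x) \<le> l2_norm M (\<lambda>x. (f x - g1 x) - g0 x)"
        by (rule power2_le_imp_le) simp
      also have "\<dots> < e"
        using g(2) g01(3) by (simp add: algebra_simps)
      finally show ?thesis using g01(2) by blast
    qed
    then show "f \<in> closed_span M (wavelet_fun ` I2)"
      using fL by (simp add: closed_span_def l2_closure_def)
  qed
qed

lemma refinable_phi: "refinable M Vsp (indicator Z2)"
proof -
  have phi: "(\<lambda>x. indicator Z2 (x - a)) = ball_fun 0 a" for a
    using phi_dilate_translate[of 0 a] by simp
  have "ball_fun 0 ` I2 = range (ball_fun 0)"
    using phi_dilate_translate_set[of 0] phi by auto
  then have "closed_span M (ball_fun 0 ` I2) = Vsp 0"
    by (simp add: Vsp_def)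
  then have "orthonormal_basis M (Vsp 0) I2 (ball_fun 0)"
    by (simp add: orthonormal_basis_def ball_fun_orthonormal ball_fun_Vsp)
  moreover have "indicator Z2 \<in> Vsp 0"
    using ball_fun_Vsp[of 0 0] phi[of 0] by simp
  ultimately show ?thesis
    by (simp add: refinable_def phi)
qed

lemma is_MRA_Vsp: "is_MRA M Vsp"
  unfolding is_MRA_def
  using closed_subspace_Vsp Vsp_Suc Vsp_dense Inter_Vsp Vsp_dilate_iff refinable_phi by blast

lemma wavelet_function_Vsp:
  "wavelet_function M Vsp (\<lambda>x. indicator Z2 (x / 2) - indicator Z2 (x / 2 - 1 / 2))"
proof -
  have mem: "wavelet_fun a \<in> wavelet_space M Vsp" for a
    by (simp add: wavelet_space_Vsp wavelet_fun_Vsp wavelet_fun_orthogonal_ball_fun)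
  have "orthonormal_basis M (wavelet_space M Vsp) I2 wavelet_fun"
    by (simp add: orthonormal_basis_def mem wavelet_fun_orthonormal closed_span_wavelet_fun)
  then show ?thesis
    by (simp add: wavelet_function_def mem wavelet_fun_0 wavelet_fun_translate)
qed

end

theorem mainTheorem2:
  fixes M :: "Q2 measure"
    and \<phi> \<psi> :: "Q2 \<Rightarrow> complex"
    and V :: "int \<Rightarrow> (Q2 \<Rightarrow> complex) set"
  assumes haar: "normalized_haar M"
    and phi: "\<phi> = indicator Z2"
    and V: "V = (\<lambda>j. closed_span M {(\<lambda>x. \<phi> (2 powi (- j) * x - a)) | a. a \<in> I2})"
    and psi: "\<psi> = (\<lambda>x. \<phi> (x / 2) - \<phi> (x / 2 - 1 / 2))"
  shows "is_MRA M V \<and> wavelet_function M V \<psi>"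
proof -
  interpret Q2_haar M by unfold_locales (rule haar)
  have "V = Vsp"
    unfolding V phi phi_dilate_translate_set Vsp_def[abs_def] ..
  then show ?thesis
    using is_MRA_Vsp wavelet_function_Vsp by (simp add: psi phi)
qed

end
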